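(* Let $\mathbb{K}\in\{\mathbb{R},\mathbb{C}\}$ and let $\|\cdot\|$ be a normalized, uniformly generated, unitarily invariant, submultiplicative matrix norm, with associated constant $\mu\in[1,3]$ as defined in the context. Let $A,E\in\mathbb{K}^{m\times n}$, $\tilde A=A+E$, $\operatorname{rank}(A)=k\ge 1$, and let $A=W_k\Sigma_kV_k^*$ be the truncated SVD of $A$ of order $k$. Let $I\subset\{1,\dots,m\}$, $J\subset\{1,\dots,n\}$, and put $U=A(I,J)$, $\tilde C=\tilde A(:,J)$, $\tilde R=\tilde A(I,:)$, $\tilde U=\tilde A(I,J)$, $E_I=E(I,:)$, $E_J=E(:,J)$, $E_{I,J}=E(I,J)$, $W_{k,I}=W_k(I,:)$, $V_{k,J}=V_k(J,:)$. Let $\tilde U_k$ be the best rank-$k$ approximation of $\tilde U$ (its truncated SVD of order $k$). Suppose $\operatorname{rank}(U)=k$ and $\sigma_k(U)>2\mu\|E_{I,J}\|$. Then $$\begin{aligned}\|A-\tilde C\tilde U_k^\dagger\tilde R\|\le{}&\frac{\|U^\dagger\|}{1-2\mu\|U^\dagger\|_2\|E_{I,J}\|}\Big\{2\|E_{I,J}\|\Big[\|E_I\|\|W_{k,I}^\dagger\|+\|E_J\|\|V_{k,J}^\dagger\|+2\|E_{I,J}\|\|W_{k,I}^\dagger\|\|V_{k,J}^\dagger\|\Big]+\|E_I\|\|E_J\|\Big\}\\&+\|W_{k,I}^\dagger\|\|E_I\|+\|V_{k,J}^\dagger\|\|E_J\|+6\|W_{k,I}^\dagger\|\|V_{k,J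}^\dagger\|\|E_{I,J}\|.\end{aligned}$$
   Context: $B^\dagger$ is the Moore--Penrose pseudoinverse, $\sigma_1(B)\ge\sigma_2(B)\ge\cdots$ are the singular values of $B$, and $\|\cdot\|_2$ is the spectral norm. $A(I,:)$, $A(:,J)$, $A(I,J)$ denote the submatrices of $A$ with rows indexed by $I$, columns indexed by $J$, and entries indexed by $I\times J$, respectively. The truncated SVD of order $k$ of $B$ is $W_k\Sigma_kV_k^*$, where $W_k$, $V_k$ consist of the first $k$ left, right singular vectors (as columns) and $\Sigma_k$ is the $k\times k$ diagonal matrix of the $k$ largest singular values. The norm $\|\cdot\|$ is a family of norms on $\bigcup_{m,n\ge1}\mathbb{K}^{m\times n}$ that is: unitarily invariant ($\|PBQ\|=\|B\|$ for unitary $P,Q$); normalized ($\|x\|=\|x\|_2$ for every vector $x$ regarded as a matrix); uniformly generated ($\|B\|=\phi(\sigma_1(B),\sigma_2(B),\dots,0,0,\dots)$ for a single symmetric function $\phi$ independent of the size of $B$); and submultiplicative ($\|BD\|\le\|B\|\|D\|$ whenever the product is defined). $\mu$ is a constant with $1\le\mu\le3$, depending only on the norm, such that for all sizes and all matrices $B,\tilde B$ of the same size with $\operatorname{rank}(B)=\operatorname{rank}(\tilde B)$ one has $\|B^\dagger-\tilde B^\dagger\|\le\mu\|\tilde B^\dagger\|_2\|B^\dagger\|_2\|\tilde B-B\|$ (such a constant exists by a theorem of Stewart; $\mu=3$ is always admissible). *)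

theory Defs
  imports
    "HOL-Library.Multiset"
    "Jordan_Normal_Form.Schur_Decomposition"
    "Jordan_Normal_Form.DL_Rank"
    "Jordan_Normal_Form.DL_Submatrix"
begin

text \<open>
  Both scalar fields are treated at once: a matrix over \<open>K\<close>, where \<open>K\<close> is the set of all
  complex numbers or the set of real ones, is a complex matrix with all entries in \<open>K\<close>.
  Rank, singular values and pseudoinverse of a real matrix do not depend on whether it is read
  over the reals or over the complex numbers. Rows and columns are numbered from 0, and the index
  sets \<open>I\<close>, \<open>J\<close> are sets of such numbers; \<^const>\<open>submatrix\<close> with \<open>UNIV\<close> keeps all rows (columns).
\<close>

definition mats :: "complex set \<Rightarrow> nat \<Rightarrow> nat \<Rightarrow> complex mat set" where
  "mats K m n = {B \<in> carrier_mat m n. elements_mat B \<subseteq> K}"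

definition mat_rank :: "complex mat \<Rightarrow> nat" where
  "mat_rank B = vec_space.rank (dim_row B) B"

definition is_unitary :: "complex mat \<Rightarrow> bool" where
  "is_unitary P \<longleftrightarrow> square_mat P \<and>
     mat_adjoint P * P = 1\<^sub>m (dim_row P) \<and> P * mat_adjoint P = 1\<^sub>m (dim_row P)"

text \<open>The Moore--Penrose pseudoinverse, as the unique solution of the four Penrose equations.\<close>

definition is_pinv :: "complex mat \<Rightarrow> complex mat \<Rightarrow> bool" where
  "is_pinv B X \<longleftrightarrow> X \<in> carrier_mat (dim_col B) (dim_row B) \<and>
     B * X * B = B \<and> X * B * X = X \<and>
     mat_adjoint (B * X) = B * X \<and> mat_adjoint (X * B) = X * B"

definition pinv :: "complex mat \<Rightarrow> complex mat" where
  "pinv B = (THE X. is_pinv B X)"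

text \<open>
  The singular values of \<open>B\<close> are the square roots of the eigenvalues of \<open>B\<^sup>* B\<close>, counted with
  multiplicity and in decreasing order. These eigenvalues are nonnegative reals, so taking
  the real part loses nothing. \<open>sv B i\<close> is the \<open>i\<close>-th one, \<open>i \<ge> 1\<close>; the sequence is continued
  by zeros.
\<close>

definition sv_list :: "complex mat \<Rightarrow> real list" where
  "sv_list B = rev (sorted_list_of_multiset
     (image_mset (\<lambda>z. sqrt (Re z)) (proots (char_poly (mat_adjoint B * B)))))"

definition sv :: "complex mat \<Rightarrow> nat \<Rightarrow> real" where
  "sv B i = (if 1 \<le> i \<and> i \<le> length (sv_list B) then sv_list B ! (i - 1) else 0)"

definition spectral_norm :: "complex mat \<Rightarrow> real" where
  "spectral_norm B = sv B 1"

definition sv_diag :: "nat \<Rightarrow> nat \<Rightarrow> complex mat \<Rightarrow> complex mat" where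
  "sv_diag p q B = mat p q (\<lambda>(i, j). if i = j then complex_of_real (sv B (Suc i)) else 0)"

definition is_svd :: "complex set \<Rightarrow> complex mat \<Rightarrow> complex mat \<Rightarrow> complex mat \<Rightarrow> bool" where
  "is_svd K B W V \<longleftrightarrow>
     W \<in> mats K (dim_row B) (dim_row B) \<and> is_unitary W \<and>
     V \<in> mats K (dim_col B) (dim_col B) \<and> is_unitary V \<and>
     B = W * sv_diag (dim_row B) (dim_col B) B * mat_adjoint V"

text \<open>
  The factors of a truncated SVD come from an arbitrary SVD; they need not be unique.
\<close>

definition is_truncated_svd ::
  "complex set \<Rightarrow> nat \<Rightarrow> complex mat \<Rightarrow> complex mat \<Rightarrow> complex mat \<Rightarrow> complex mat \<Rightarrow> bool" where
  "is_truncated_svd K k B Wk Sk Vk \<longleftrightarrow> k \<le> min (dim_row B) (dim_col B) \<and>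
     (\<exists>W V. is_svd K B W V \<and>
        Wk = submatrix W UNIV {..<k} \<and> Sk = sv_diag k k B \<and> Vk = submatrix V UNIV {..<k})"

text \<open>
  A family of norms on the spaces of \<open>m \<times> n\<close> matrices over \<open>K\<close>, \<open>m, n \<ge> 1\<close>, is a function on
  complex matrices of which only the values on these spaces matter.
\<close>

definition matrix_norm_family :: "complex set \<Rightarrow> (complex mat \<Rightarrow> real) \<Rightarrow> bool" where
  "matrix_norm_family K N \<longleftrightarrow> (\<forall>m\<ge>1. \<forall>n\<ge>1. \<forall>B\<in>mats K m n.
     0 \<le> N B \<and>
     (N B = 0 \<longleftrightarrow> B = 0\<^sub>m m n) \<and>
     (\<forall>c\<in>K. N (c \<cdot>\<^sub>m B) = cmod c * N B) \<and>
     (\<forall>D\<in>mats K m n. N (B + D) \<le> N B + N D))"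

definition unitarily_invariant :: "complex set \<Rightarrow> (complex mat \<Rightarrow> real) \<Rightarrow> bool" where
  "unitarily_invariant K N \<longleftrightarrow> (\<forall>m\<ge>1. \<forall>n\<ge>1. \<forall>B\<in>mats K m n. \<forall>P\<in>mats K m m. \<forall>Q\<in>mats K n n.
     is_unitary P \<longrightarrow> is_unitary Q \<longrightarrow> N (P * B * Q) = N B)"

definition normalized_norm :: "complex set \<Rightarrow> (complex mat \<Rightarrow> real) \<Rightarrow> bool" where
  "normalized_norm K N \<longleftrightarrow> (\<forall>m\<ge>1. \<forall>x\<in>mats K m 1. N x = sqrt (\<Sum>i<m. (cmod (x $$ (i, 0)))\<^sup>2))"

definition symmetric_seq_fun :: "((nat \<Rightarrow> real) \<Rightarrow> real) \<Rightarrow> bool" where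
  "symmetric_seq_fun \<phi> \<longleftrightarrow> (\<forall>x p. finite {i. x i \<noteq> 0} \<longrightarrow> bij p \<longrightarrow> \<phi> (x \<circ> p) = \<phi> x)"

definition uniformly_generated :: "complex set \<Rightarrow> (complex mat \<Rightarrow> real) \<Rightarrow> bool" where
  "uniformly_generated K N \<longleftrightarrow> (\<exists>\<phi>. symmetric_seq_fun \<phi> \<and>
     (\<forall>m\<ge>1. \<forall>n\<ge>1. \<forall>B\<in>mats K m n. N B = \<phi> (\<lambda>i. sv B (Suc i))))"

definition submultiplicative_norm :: "complex set \<Rightarrow> (complex mat \<Rightarrow> real) \<Rightarrow> bool" where
  "submultiplicative_norm K N \<longleftrightarrow> (\<forall>m\<ge>1. \<forall>n\<ge>1. \<forall>p\<ge>1. \<forall>B\<in>mats K m n. \<forall>D\<in>mats K n p.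
     N (B * D) \<le> N B * N D)"

definition pinv_perturbation_const :: "complex set \<Rightarrow> (complex mat \<Rightarrow> real) \<Rightarrow> real \<Rightarrow> bool" where
  "pinv_perturbation_const K N \<mu> \<longleftrightarrow> 1 \<le> \<mu> \<and> \<mu> \<le> 3 \<and>
     (\<forall>m\<ge>1. \<forall>n\<ge>1. \<forall>B\<in>mats K m n. \<forall>B'\<in>mats K m n. mat_rank B = mat_rank B' \<longrightarrow>
        N (pinv B - pinv B') \<le> \<mu> * spectral_norm (pinv B') * spectral_norm (pinv B) * N (B' - B))"

end

theory Submission
  imports Defs
begin

text \<open>
  Since \<open>U\<close> has rank \<open>k\<close>, both \<open>W\<^sub>k\<^sub>,\<^sub>I\<close> and \<open>V\<^sub>k\<^sub>,\<^sub>J\<close> have full column rank, so with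
  \<open>L = W\<^sub>k W\<^sub>k\<^sub>,\<^sub>I\<^sup>\<dagger>\<close> and \<open>R = (V\<^sub>k V\<^sub>k\<^sub>,\<^sub>J\<^sup>\<dagger>)\<^sup>*\<close> one has \<open>A(:,J) = L U\<close>,
  \<open>A(I,:) = U R\<close> and \<open>A = L U R\<close>. Put \<open>X = U~\<^sub>k\<^sup>\<dagger>\<close> and \<open>D = U~\<^sub>k - U\<close>. Mirsky's theorem gives
  \<open>\<parallel>D\<parallel> \<le> 2 \<parallel>E\<^sub>I\<^sub>,\<^sub>J\<parallel>\<close>. Expanding \<open>A - (L U + E\<^sub>J) X (U R + E\<^sub>I)\<close> and replacing \<open>U\<close> by
  \<open>U~\<^sub>k - D\<close> next to \<open>X\<close> leaves only the orthogonal projections \<open>U~\<^sub>k X\<close> and \<open>X U~\<^sub>k\<close>, which do not increase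
  a unitarily invariant norm, and terms with a factor \<open>X\<close>, whose norm is controlled by the perturbation
  bound for pseudoinverses, because \<open>\<parallel>X\<parallel>\<^sub>2 \<le> \<parallel>X\<parallel>\<close>.
\<close>

section \<open>Adjoints, Euclidean length and the spectral theorem\<close>

text \<open>The norm is known only through its axioms, so its properties are drawn from singular
  values. Mirsky's theorem is needed for one competitor only: \<open>U\<close> has rank
  \<open>k\<close>, so \<open>U~_k\<close> is at least as close to \<open>U~\<close> as
  \<open>U\<close> is, and a triangle inequality gives the factor 2. This case follows from
  \<open>\<sigma>_{k+i}(B) \<le> \<sigma>_i(B - F)\<close> for \<open>F\<close> of rank at most
  \<open>k\<close> and from monotonicity of the norm in the singular values, which convexity and
  sign flips provide. The perturbation bound for pseudoinverses demands equal ranks. The gap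
  hypothesis secures them: as \<open>\<mu> \<ge> 1\<close>, \<open>\<sigma>_k(U)\<close> exceeds
  \<open>||D||_2\<close>, so the \<open>k\<close>-th singular value of \<open>U + D\<close> stays
  positive. The bound then has \<open>||X||\<close> on both sides; solving for it produces the
  denominator, which is positive because \<open>||pinv U||_2 \<sigma>_k(U) \<le> 1\<close>. The
  spectral theorem is used over the complex numbers even for real matrices: its unitary factor only
  serves to compare singular values, while the norm is applied to matrices over \<open>K\<close>
  alone.\<close>

lemma dim_mat_adjoint [simp]:
  "dim_row (mat_adjoint A) = dim_col A" "dim_col (mat_adjoint A) = dim_row A"
  by (auto simp: mat_adjoint_def mat_of_rows_def)

lemma mat_adjoint_carrier [simp, intro]:
  "A \<in> carrier_mat m n \<Longrightarrow> mat_adjoint A \<in> carrier_mat n m"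
  by (auto intro!: carrier_matI)

lemma mat_adjoint_index [simp]:
  fixes A :: "complex mat"
  shows "i < dim_col A \<Longrightarrow> j < dim_row A \<Longrightarrow> mat_adjoint A $$ (i, j) = cnj (A $$ (j, i))"
  by (auto simp: mat_adjoint_def mat_of_rows_def)

lemma mat_adjoint_adjoint [simp]: "mat_adjoint (mat_adjoint A) = (A :: complex mat)"
  by (rule eq_matI) auto

lemma mat_adjoint_one [simp]: "mat_adjoint (1\<^sub>m n) = (1\<^sub>m n :: complex mat)"
  by (rule eq_matI) auto

lemma mat_adjoint_mult:
  fixes A B :: "complex mat"
  assumes "A \<in> carrier_mat m n" "B \<in> carrier_mat n p"
  shows "mat_adjoint (A * B) = mat_adjoint B * mat_adjoint A"
  using assms by (intro eq_matI) (auto simp: scalar_prod_def mult.commute)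

lemma mat_adjoint_times:
  fixes A B :: "complex mat"
  shows "dim_col A = dim_row B \<Longrightarrow> mat_adjoint (A * B) = mat_adjoint B * mat_adjoint A"
  by (rule mat_adjoint_mult) auto

lemma mat_mult_assoc:
  fixes A B C :: "complex mat"
  shows "dim_col A = dim_row B \<Longrightarrow> dim_col B = dim_row C \<Longrightarrow> A * B * C = A * (B * C)"
  by (rule assoc_mult_mat) auto

lemma mat_vec_assoc:
  fixes A B :: "complex mat"
  shows "dim_col A = dim_row B \<Longrightarrow> dim_col B = dim_vec v \<Longrightarrow> (A * B) *\<^sub>v v = A *\<^sub>v (B *\<^sub>v v)"
  by (rule assoc_mult_mat_vec) auto

lemma mat_adjoint_minus:
  fixes A B :: "complex mat"
  assumes "A \<in> carrier_mat m n" "B \<in> carrier_mat m n"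
  shows "mat_adjoint (A - B) = mat_adjoint A - mat_adjoint B"
  using assms by (intro eq_matI) auto

definition nsq :: "complex vec \<Rightarrow> real" where
  "nsq v = (\<Sum>i<dim_vec v. (cmod (v $ i))\<^sup>2)"

lemma of_real_nsq: "complex_of_real (nsq v) = v \<bullet>c v"
  by (simp only: nsq_def of_real_sum scalar_prod_def atLeast0LessThan dim_vec_conjugate)
     (intro sum.cong, auto simp: complex_norm_square[symmetric] simp del: of_real_power)

lemma nsq_nonneg [simp]: "0 \<le> nsq v"
  by (simp add: nsq_def sum_nonneg)

lemma nsq_eq_0:
  assumes "v \<in> carrier_vec n"
  shows "nsq v = 0 \<longleftrightarrow> v = 0\<^sub>v n"
proof
  assume "nsq v = 0"
  hence "\<forall>i<n. v $ i = 0"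
    using assms by (subst (asm) nsq_def, subst (asm) sum_nonneg_eq_0_iff) auto
  thus "v = 0\<^sub>v n" using assms by auto
qed (auto simp: nsq_def)

lemma nsq_pos:
  assumes "v \<in> carrier_vec n" "v \<noteq> 0\<^sub>v n"
  shows "0 < nsq v"
  using nsq_eq_0[OF assms(1)] assms(2) nsq_nonneg[of v] by linarith

lemma cscalar_prod_adjoint:
  fixes A :: "complex mat"
  assumes "A \<in> carrier_mat m n" "x \<in> carrier_vec n" "y \<in> carrier_vec m"
  shows "(A *\<^sub>v x) \<bullet>c y = x \<bullet>c (mat_adjoint A *\<^sub>v y)"
proof -
  have "(A *\<^sub>v x) \<bullet>c y = (\<Sum>i<m. \<Sum>j<n. A $$ (i,j) * x $ j * cnj (y $ i))"
    using assms by (auto simp: scalar_prod_def atLeast0LessThan sum_distrib_right)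
  also have "\<dots> = (\<Sum>j<n. \<Sum>i<m. A $$ (i,j) * x $ j * cnj (y $ i))" by (rule sum.swap)
  also have "\<dots> = x \<bullet>c (mat_adjoint A *\<^sub>v y)"
    using assms by (auto simp: scalar_prod_def atLeast0LessThan sum_distrib_left intro!: sum.cong)
  finally show ?thesis .
qed

lemma nsq_mult_mat_vec:
  assumes "A \<in> carrier_mat m n" "x \<in> carrier_vec n"
  shows "complex_of_real (nsq (A *\<^sub>v x)) = x \<bullet>c ((mat_adjoint A * A) *\<^sub>v x)"
  unfolding of_real_nsq
  using assms by (subst cscalar_prod_adjoint[OF assms])
    (auto simp: assoc_mult_mat_vec[of _ n m _ n])

lemma nsq_isometry:
  assumes "A \<in> carrier_mat m n" "mat_adjoint A * A = 1\<^sub>m n" "x \<in> carrier_vec n"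
  shows "nsq (A *\<^sub>v x) = nsq x"
  using nsq_mult_mat_vec[OF assms(1,3)] assms(2,3) by (simp flip: of_real_nsq)

lemma cscalar_prod_swap:
  fixes x y :: "complex vec"
  assumes "x \<in> carrier_vec n" "y \<in> carrier_vec n"
  shows "y \<bullet>c x = cnj (x \<bullet>c y)"
  using assms by (auto simp: scalar_prod_def mult.commute)

text \<open>Pythagoras: \<open>P x\<close> and \<open>x - P x\<close> are orthogonal because
  \<open>P\<close> is idempotent and self-adjoint, so their squared lengths add up to that of
  \<open>x\<close>.\<close>

lemma nsq_projection_le:
  assumes P: "P \<in> carrier_mat n n" "P * P = P" "mat_adjoint P = P" and x: "x \<in> carrier_vec n"
  shows "nsq (P *\<^sub>v x) \<le> nsq x"
proof -
  let ?y = "P *\<^sub>v x" and ?z = "x - P *\<^sub>v x"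
  have c: "?y \<in> carrier_vec n" "?z \<in> carrier_vec n" using P x by auto
  have "P *\<^sub>v ?z = P *\<^sub>v x - P *\<^sub>v (P *\<^sub>v x)" using P x by (simp add: mult_minus_distrib_mat_vec)
  also have "P *\<^sub>v (P *\<^sub>v x) = P *\<^sub>v x" using P x by (simp flip: assoc_mult_mat_vec)
  also have "P *\<^sub>v x - P *\<^sub>v x = 0\<^sub>v n" using P x by auto
  finally have "x \<bullet>c (P *\<^sub>v ?z) = 0" using x by simp
  hence 0: "?y \<bullet>c ?z = 0" using cscalar_prod_adjoint[OF P(1) x c(2)] P(3) by simp
  have "complex_of_real (nsq x) = (?y + ?z) \<bullet>c (?y + ?z)"
  proof -
    have "?y + ?z = x" using P(1) x by (intro eq_vecI) auto
    thus ?thesis by (simp add: of_real_nsq)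
  qed
  also have "\<dots> = ?y \<bullet>c ?y + ?y \<bullet>c ?z + (?z \<bullet>c ?y + ?z \<bullet>c ?z)"
    using c by (simp add: conjugate_add_vec[of _ n] scalar_prod_add_distrib[of _ n] add_scalar_prod_distrib[of _ n]
        del: minus_carrier_vec)
  also have "?z \<bullet>c ?y = 0" using 0 cscalar_prod_swap[OF c] by simp
  finally have "complex_of_real (nsq x) = of_real (nsq ?y + nsq ?z)"
    using 0 by (simp add: of_real_nsq)
  thus ?thesis using nsq_nonneg[of ?z] by (simp del: of_real_add)
qed

text \<open>A diagonal Gram matrix means that the columns of \<open>A\<close> are orthogonal with
  squared lengths \<open>f j\<close>.\<close>

lemma nsq_diag_gram:
  assumes "A \<in> carrier_mat m n" "c \<in> carrier_vec n"
    and "mat_adjoint A * A = mat_diag n (\<lambda>j. complex_of_real (f j))"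
  shows "nsq (A *\<^sub>v c) = (\<Sum>j<n. f j * (cmod (c $ j))\<^sup>2)"
proof -
  have "complex_of_real (nsq (A *\<^sub>v c)) = c \<bullet>c (mat_diag n (\<lambda>j. complex_of_real (f j)) *\<^sub>v c)"
    using nsq_mult_mat_vec[OF assms(1,2)] assms(3) by simp
  also have "mat_diag n (\<lambda>j. complex_of_real (f j)) *\<^sub>v c = vec n (\<lambda>j. of_real (f j) * c $ j)"
    using assms(2) by (intro eq_vecI)
      (auto simp: mat_diag_def scalar_prod_def if_distrib[of "\<lambda>x. x * _"] atLeast0LessThan
          cong: if_cong)
  also have "c \<bullet>c \<dots> = (\<Sum>j<n. of_real (f j) * of_real ((cmod (c $ j))\<^sup>2))"
    using assms(2) unfolding scalar_prod_def
    by (auto simp: atLeast0LessThan complex_norm_square mult.commute mult.left_commute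
       simp del: of_real_power intro!: sum.cong)
  finally show ?thesis by (simp only: flip: of_real_mult of_real_sum) (simp only: of_real_eq_iff)
qed

text \<open>Source of all dimension counts. Zero rows pad \<open>G\<close> to a square matrix
  \<open>H\<close>; the last row of \<open>H\<close> is zero because \<open>r < c\<close>, so its
  determinant vanishes.\<close>

lemma wide_kernel:
  assumes G: "(G :: complex mat) \<in> carrier_mat r c" and "r < c"
  shows "\<exists>x\<in>carrier_vec c. x \<noteq> 0\<^sub>v c \<and> G *\<^sub>v x = 0\<^sub>v r"
proof -
  define H where "H = mat c c (\<lambda>(i,j). if i < r then G $$ (i,j) else 0)"
  have H: "H \<in> carrier_mat c c" by (simp add: H_def)
  have "transpose_mat H *\<^sub>v unit_vec c (c - 1) = 0\<^sub>v c"
    using assms by (intro eq_vecI) (auto simp: H_def)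
  moreover have "unit_vec c (c - 1) \<noteq> (0\<^sub>v c :: complex vec)" using assms(2) by simp
  ultimately have "det (transpose_mat H) = 0"
    using H det_0_iff_vec_prod_zero_field[of "transpose_mat H" c] unit_vec_carrier
    by (metis transpose_carrier_mat)
  hence "det H = 0" using det_transpose[OF H] by simp
  then obtain x where x: "x \<in> carrier_vec c" "x \<noteq> 0\<^sub>v c" "H *\<^sub>v x = 0\<^sub>v c"
    using det_0_iff_vec_prod_zero_field[OF H] by auto
  have "G *\<^sub>v x = 0\<^sub>v r"
  proof (rule eq_vecI)
    fix i assume "i < dim_vec (0\<^sub>v r :: complex vec)"
    hence i: "i < r" by simp
    have "row G i = row H i" using G assms i by (auto simp: H_def)
    moreover have "(H *\<^sub>v x) $ i = 0" using x i assms by simp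
    ultimately show "(G *\<^sub>v x) $ i = 0\<^sub>v r $ i" using i G H assms by auto
  qed (use G in auto)
  with x show ?thesis by auto
qed

lemma injective_square_inverse:
  assumes G: "(G :: complex mat) \<in> carrier_mat n n"
    and inj: "\<And>x. x \<in> carrier_vec n \<Longrightarrow> G *\<^sub>v x = 0\<^sub>v n \<Longrightarrow> x = 0\<^sub>v n"
  obtains G' where "G' \<in> carrier_mat n n" "G' * G = 1\<^sub>m n" "G * G' = 1\<^sub>m n"
proof -
  have "det G \<noteq> 0" using det_0_iff_vec_prod_zero_field[OF G] inj by auto
  from det_non_zero_imp_unit[OF G this, of "undefined"]
  show ?thesis using that by (auto simp: Units_def ring_mat_def)
qed

section \<open>Unitary diagonalization of Hermitian matrices\<close>

lemma mat_adjoint_block_diag: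
  fixes a :: "complex mat"
  assumes "a \<in> carrier_mat 1 1" "B \<in> carrier_mat n n"
  shows "mat_adjoint (four_block_mat a (0\<^sub>m 1 n) (0\<^sub>m n 1) B) =
    four_block_mat (mat_adjoint a) (0\<^sub>m 1 n) (0\<^sub>m n 1) (mat_adjoint B)"
  using assms by (intro eq_matI) auto

lemma mult_block_diag:
  fixes a :: "complex mat"
  assumes "a \<in> carrier_mat 1 1" "B \<in> carrier_mat n n" "a' \<in> carrier_mat 1 1" "B' \<in> carrier_mat n n"
  shows "four_block_mat a (0\<^sub>m 1 n) (0\<^sub>m n 1) B * four_block_mat a' (0\<^sub>m 1 n) (0\<^sub>m n 1) B' =
    four_block_mat (a * a') (0\<^sub>m 1 n) (0\<^sub>m n 1) (B * B')"
  using assms by (subst mult_four_block_mat) auto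

text \<open>Gram-Schmidt on a basis starting with \<open>v\<close> leaves \<open>v\<close> in front,
  but its vectors are only orthogonal. Dividing each by its length \<open>r j\<close> gives the
  columns, whence the factor \<open>s\<close> before \<open>v\<close>.\<close>

lemma unitary_with_first_column:
  assumes v: "v \<in> carrier_vec (Suc n)" "v \<noteq> 0\<^sub>v (Suc n)"
  obtains W :: "complex mat" and s where "W \<in> carrier_mat (Suc n) (Suc n)"
    "mat_adjoint W * W = 1\<^sub>m (Suc n)" "W * mat_adjoint W = 1\<^sub>m (Suc n)" "col W 0 = s \<cdot>\<^sub>v v"
proof -
  let ?n = "Suc n"
  interpret cof_vec_space ?n "TYPE(complex)" .
  define b where "b = basis_completion v"
  define ws where "ws = gram_schmidt ?n b"
  have b: "set b \<subseteq> carrier_vec ?n" "distinct b" "\<not> lin_dep (set b)" "length b = ?n" "hd b = v"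
    using basis_completion[OF v] by (auto simp: b_def)
  from b obtain vs where bv: "b = v # vs" by (cases b) auto
  have ws: "set ws \<subseteq> carrier_vec ?n" "corthogonal ws" "length ws = ?n"
    using gram_schmidt_result[OF b(1,2,3) ws_def] b by auto
  have hd: "hd ws = v" using gram_schmidt_hd[OF v(1), of vs] by (simp add: ws_def bv)
  hence ws0: "ws ! 0 = v" using ws(3) by (metis hd_conv_nth length_0_conv nat.simps(3))
  have wc: "ws ! i \<in> carrier_vec ?n" if "i < ?n" for i using that ws by auto
  define r where "r j = complex_of_real (sqrt (nsq (ws ! j)))" for j
  define W where "W = mat ?n ?n (\<lambda>(i,j). ws ! j $ i / r j)"
  have r: "r j * r j = ws ! j \<bullet>c ws ! j" "cnj (r j) = r j" for j
    by (auto simp: r_def of_real_nsq[symmetric] simp flip: of_real_mult)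
  have r0: "r j \<noteq> 0" if "j < ?n" for j
    using corthogonalD[OF ws(2), of j j] that ws(3) r(1)[of j] by auto
  have W: "W \<in> carrier_mat ?n ?n" by (simp add: W_def)
  have WW: "mat_adjoint W * W = 1\<^sub>m ?n"
  proof (rule eq_matI)
    fix i j assume "i < dim_row (1\<^sub>m ?n :: complex mat)" "j < dim_col (1\<^sub>m ?n :: complex mat)"
    hence ij: "i < ?n" "j < ?n" by auto
    have "(mat_adjoint W * W) $$ (i,j) = (\<Sum>k<?n. cnj (ws ! i $ k / r i) * (ws ! j $ k / r j))"
      using ij W by (simp add: scalar_prod_def atLeast0LessThan) (simp add: W_def)
    also have "\<dots> = (ws ! j \<bullet>c ws ! i) / (r i * r j)"
      using wc[OF ij(1)] wc[OF ij(2)]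
      by (simp add: scalar_prod_def atLeast0LessThan sum_divide_distrib r mult.commute del: sum.lessThan_Suc)
    also have "\<dots> = (1\<^sub>m ?n :: complex mat) $$ (i,j)"
      using corthogonalD[OF ws(2), of j i] ij ws(3) r0[of i] r(1)[of i] by (cases "i = j") auto
    finally show "(mat_adjoint W * W) $$ (i,j) = (1\<^sub>m ?n :: complex mat) $$ (i,j)" .
  qed (use W in auto)
  have "W * mat_adjoint W = 1\<^sub>m ?n"
    by (rule mat_mult_left_right_inverse[OF _ W WW]) (use W in auto)
  moreover have "col W 0 = (1 / r 0) \<cdot>\<^sub>v v"
    using v ws0 by (auto simp: W_def)
  ultimately show ?thesis using that W WW by blast
qed

text \<open>Deflation: conjugation by a unitary matrix whose first column is an eigenvector for
  \<open>e\<close> splits off \<open>e\<close>, and the rest is Hermitian with the remaining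
  eigenvalues. The order of \<open>es\<close> is free, so the singular values can later be taken in
  decreasing order.\<close>

lemma hermitian_diagonalization:
  fixes H :: "complex mat"
  assumes "H \<in> carrier_mat n n" "mat_adjoint H = H"
    and "char_poly H = (\<Prod>e\<leftarrow>es. [:- e, 1:])"
  shows "\<exists>P\<in>carrier_mat n n. mat_adjoint P * P = 1\<^sub>m n \<and> P * mat_adjoint P = 1\<^sub>m n \<and>
    mat_adjoint P * H * P = mat_diag n (\<lambda>i. es ! i)"
  using assms
proof (induction es arbitrary: n H)
  case Nil
  hence "n = 0" using degree_monic_char_poly[OF Nil(1)] by simp
  thus ?case using Nil by (intro bexI[of _ "1\<^sub>m 0"]) (auto simp: mat_diag_def intro!: eq_matI)
next
  case (Cons e es n H)
  note H = Cons.prems(1)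
  have cp: "char_poly H = [:- e, 1:] * (\<Prod>e\<leftarrow>es. [:- e, 1:])" using Cons.prems(3) by simp
  have "n \<noteq> 0"
  proof
    assume "n = 0"
    hence "degree (char_poly H) = 0" using degree_monic_char_poly[OF H] by simp
    moreover have "degree (char_poly H) = Suc (degree (\<Prod>e\<leftarrow>es. [:- e, 1:]))"
      unfolding cp by (subst degree_mult_eq) (auto simp: prod_list_zero_iff)
    ultimately show False by simp
  qed
  then obtain n1 where n: "n = Suc n1" by (cases n) auto
  have "eigenvalue H e" unfolding eigenvalue_root_char_poly[OF H] cp by simp
  then obtain v where v: "v \<in> carrier_vec n" "v \<noteq> 0\<^sub>v n" "H *\<^sub>v v = e \<cdot>\<^sub>v v"
    using H unfolding eigenvalue_def eigenvector_def by auto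
  from unitary_with_first_column[of v n1] v n obtain W s where
    W: "W \<in> carrier_mat n n" "mat_adjoint W * W = 1\<^sub>m n" "W * mat_adjoint W = 1\<^sub>m n"
    and col: "col W 0 = s \<cdot>\<^sub>v v" by metis
  define H' where "H' = mat_adjoint W * H * W"
  have H': "H' \<in> carrier_mat n n" using W(1) H
    by (auto simp: H'_def intro!: mult_carrier_mat)
  have H'adj: "mat_adjoint H' = H'"
    unfolding H'_def using W(1) H Cons.prems(2)
    by (simp add: mat_adjoint_mult[of _ n n _ n] assoc_mult_mat[of _ n n _ n _ n])
  have "col H' 0 = mat_adjoint W *\<^sub>v (H *\<^sub>v col W 0)"
  proof -
    have "col H' 0 = col (mat_adjoint W * (H * W)) 0"
      using W(1) H by (simp add: H'_def assoc_mult_mat[of _ n n _ n _ n])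
    also have "\<dots> = mat_adjoint W *\<^sub>v (H *\<^sub>v col W 0)"
    proof -
      have "0 < n" by (simp add: n)
      thus ?thesis
        using col_mult2[OF mat_adjoint_carrier[OF W(1)] mult_carrier_mat[OF H W(1)]] col_mult2[OF H W(1)]
        by (simp only:)
    qed
    finally show ?thesis .
  qed
  also have "H *\<^sub>v col W 0 = e \<cdot>\<^sub>v col W 0"
    unfolding col using v H by (simp add: mult_mat_vec smult_smult_assoc mult.commute)
  also have "mat_adjoint W *\<^sub>v (e \<cdot>\<^sub>v col W 0) = e \<cdot>\<^sub>v col (mat_adjoint W * W) 0"
    using mult_mat_vec[OF mat_adjoint_carrier[OF W(1)] col_carrier_vec[OF _ W(1)], of 0 e]
      col_mult2[OF mat_adjoint_carrier[OF W(1)] W(1), of 0] W(1) n by simp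
  also have "\<dots> = e \<cdot>\<^sub>v unit_vec n 0" using W(2) n by simp
  finally have col0: "col H' 0 = e \<cdot>\<^sub>v unit_vec n 0" .
  have c0: "H' $$ (i, 0) = (if i = 0 then e else 0)" if "i < n" for i
    using arg_cong[OF col0, of "\<lambda>v. v $ i"] that H' n by auto
  have r0: "H' $$ (0, i) = (if i = 0 then cnj e else 0)" if "i < n" for i
  proof -
    have "H' $$ (0, i) = mat_adjoint H' $$ (0, i)" by (simp add: H'adj)
    thus ?thesis using that H' n c0[OF that] by (subst (asm) mat_adjoint_index) auto
  qed
  define a where "a = mat 1 1 (\<lambda>_. e)"
  define A3 where "A3 = mat n1 n1 (\<lambda>(i,j). H' $$ (Suc i, Suc j))"
  have a: "a \<in> carrier_mat 1 1" and A3: "A3 \<in> carrier_mat n1 n1" by (auto simp: a_def A3_def)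
  \<comment> \<open>The corner entry is \<open>e\<close> when read off the first column and
    \<open>cnj e\<close> when read off the first row.\<close>
  have ce: "cnj e = e" using c0[of 0] r0[of 0] n by simp
  have block: "H' = four_block_mat a (0\<^sub>m 1 n1) (0\<^sub>m n1 1) A3"
    using H' n c0 r0 ce by (intro eq_matI) (auto simp: a_def A3_def)
  have A3adj: "mat_adjoint A3 = A3"
  proof (rule eq_matI)
    fix i j assume "i < dim_row A3" "j < dim_col A3"
    hence ij: "i < n1" "j < n1" by (auto simp: A3_def)
    have "mat_adjoint H' $$ (Suc i, Suc j) = H' $$ (Suc i, Suc j)" by (simp add: H'adj)
    thus "mat_adjoint A3 $$ (i,j) = A3 $$ (i,j)" using ij n H' by (simp add: A3_def)
  qed (auto simp: A3_def)
  have "similar_mat_wit H' H (mat_adjoint W) W"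
    by (rule similar_mat_witI[of _ _ n]) (use W H H' in \<open>auto simp: H'_def\<close>)
  hence "char_poly H' = char_poly H" by (intro char_poly_similar) (auto simp: similar_mat_def)
  moreover have "char_poly H' = char_poly a * char_poly A3"
    unfolding block by (rule char_poly_four_block_zeros_col[OF a _ A3]) auto
  moreover have "char_poly a = [:- e, 1:]"
    by (simp add: a_def char_poly_defs det_def sign_def)
  ultimately have "char_poly A3 = (\<Prod>e\<leftarrow>es. [:- e, 1:])"
    using cp by (metis mult_cancel_left pCons_eq_0_iff zero_neq_one)
  from Cons.IH[OF A3 A3adj this] obtain P where P: "P \<in> carrier_mat n1 n1"
    "mat_adjoint P * P = 1\<^sub>m n1" "P * mat_adjoint P = 1\<^sub>m n1"
    "mat_adjoint P * A3 * P = mat_diag n1 (\<lambda>i. es ! i)" by auto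
  define Q where "Q = four_block_mat (1\<^sub>m 1) (0\<^sub>m 1 n1) (0\<^sub>m n1 1) P"
  have Qadj: "mat_adjoint Q = four_block_mat (1\<^sub>m 1) (0\<^sub>m 1 n1) (0\<^sub>m n1 1) (mat_adjoint P)"
    unfolding Q_def using P by (simp add: mat_adjoint_block_diag del: One_nat_def)
  have Q: "Q \<in> carrier_mat n n" using P(1) n by (auto simp: Q_def)
  have QQ: "mat_adjoint Q * Q = 1\<^sub>m n" "Q * mat_adjoint Q = 1\<^sub>m n"
    unfolding Qadj unfolding Q_def using P by (simp_all add: mult_block_diag n Suc_eq_plus1_left del: One_nat_def)
  have QHQ: "mat_adjoint Q * H' * Q = mat_diag n (\<lambda>i. (e # es) ! i)"
  proof -
    have "mat_adjoint Q * H' * Q = four_block_mat a (0\<^sub>m 1 n1) (0\<^sub>m n1 1) (mat_diag n1 (\<lambda>i. es ! i))"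
      unfolding Qadj block unfolding Q_def
      using P a A3 mult_carrier_mat[OF mat_adjoint_carrier[OF P(1)] A3]
      by (simp add: mult_block_diag del: One_nat_def)
    also have "\<dots> = mat_diag n (\<lambda>i. (e # es) ! i)"
      using n by (intro eq_matI) (auto simp: mat_diag_def a_def nth_Cons')
    finally show ?thesis .
  qed
  have "mat_adjoint (W * Q) * (W * Q) = mat_adjoint Q * (mat_adjoint W * W) * Q"
    using W(1) Q by (simp add: mat_adjoint_times mat_mult_assoc)
  hence 1: "mat_adjoint (W * Q) * (W * Q) = 1\<^sub>m n" using W(2) QQ(1) Q by simp
  have 2: "(W * Q) * mat_adjoint (W * Q) = 1\<^sub>m n"
    by (rule mat_mult_left_right_inverse[OF _ _ 1]) (use W Q in auto)
  have 3: "mat_adjoint (W * Q) * H * (W * Q) = mat_adjoint Q * H' * Q"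
    unfolding H'_def using W(1) Q H
    by (simp add: mat_adjoint_times mat_mult_assoc)
  show ?case
    by (rule bexI[of _ "W * Q"]) (use 1 2 3 QHQ W(1) Q in auto)
qed

section \<open>Singular values\<close>

lemma gram_carrier: "(F :: complex mat) \<in> carrier_mat p q \<Longrightarrow> mat_adjoint F * F \<in> carrier_mat q q"
  by (auto intro: mult_carrier_mat)

lemma gram_hermitian:
  "(F :: complex mat) \<in> carrier_mat p q \<Longrightarrow> mat_adjoint (mat_adjoint F * F) = mat_adjoint F * F"
  by (simp add: mat_adjoint_times)

text \<open>An eigenvector \<open>v\<close> exhibits \<open>e\<close> as the Rayleigh quotient
  \<open>nsq (F v) / nsq v\<close>, a nonnegative real.\<close>

lemma gram_eigenvalue:
  assumes F: "F \<in> carrier_mat p q" and e: "eigenvalue (mat_adjoint F * F) e"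
  shows "0 \<le> Re e" "complex_of_real ((sqrt (Re e))\<^sup>2) = e"
proof -
  from e F obtain v where v: "v \<in> carrier_vec q" "v \<noteq> 0\<^sub>v q"
    "(mat_adjoint F * F) *\<^sub>v v = e \<cdot>\<^sub>v v"
    by (auto simp: eigenvalue_def eigenvector_def)
  have "complex_of_real (nsq (F *\<^sub>v v)) = v \<bullet>c (e \<cdot>\<^sub>v v)"
    using nsq_mult_mat_vec[OF F v(1)] v(3) by simp
  also have "\<dots> = cnj e * of_real (nsq v)"
    using v(1) by (simp add: of_real_nsq conjugate_smult_vec)
  finally have "complex_of_real (nsq (F *\<^sub>v v) / nsq v) = cnj e"
    using nsq_pos[OF v(1,2)] by simp
  hence "cnj (complex_of_real (nsq (F *\<^sub>v v) / nsq v)) = e" by simp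
  hence e: "complex_of_real (nsq (F *\<^sub>v v) / nsq v) = e" by simp
  show "0 \<le> Re e" by (simp flip: e)
  thus "complex_of_real ((sqrt (Re e))\<^sup>2) = e" by (simp flip: e)
qed

lemma proots_prod_linear:
  "proots (\<Prod>a\<leftarrow>as. [:- a, 1:]) = mset (as :: 'a :: idom list)"
proof (induction as)
  case (Cons a as)
  have "(\<Prod>a\<leftarrow>as. [:- a, 1:]) \<noteq> 0" by (auto simp: prod_list_zero_iff)
  thus ?case using Cons by (simp add: proots_mult del: mult_pCons_left)
qed simp

text \<open>Squaring the entries of \<open>sv_list\<close> recovers the eigenvalues of the Gram
  matrix with multiplicity. The factorization in the order of \<open>sv_list\<close> is the form
  that \<open>hermitian_diagonalization\<close> takes as input.\<close>

lemma sv_list_gram: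
  assumes F: "F \<in> carrier_mat p q"
  shows "length (sv_list F) = q"
    and "char_poly (mat_adjoint F * F) = (\<Prod>x\<leftarrow>map (\<lambda>s. complex_of_real (s\<^sup>2)) (sv_list F). [:- x, 1:])"
    and "sorted (rev (sv_list F))" and "\<And>s. s \<in> set (sv_list F) \<Longrightarrow> 0 \<le> s"
proof -
  let ?H = "mat_adjoint F * F"
  have H: "?H \<in> carrier_mat q q" using F by (rule gram_carrier)
  obtain as where as: "char_poly ?H = (\<Prod>a\<leftarrow>as. [:- a, 1:])" "length as = q"
    using char_poly_factorized[OF H] by auto
  have ev: "0 \<le> Re a \<and> complex_of_real ((sqrt (Re a))\<^sup>2) = a" if "a \<in> set as" for a
  proof -
    have "poly (char_poly ?H) a = 0" unfolding as(1) using that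
      by (auto simp: poly_prod_list prod_list_zero_iff intro!: image_eqI[of _ _ a])
    hence "eigenvalue ?H a" using eigenvalue_root_char_poly[OF H] by simp
    thus ?thesis using gram_eigenvalue[OF F] by blast
  qed
  have sv: "sv_list F = rev (sort (map (\<lambda>z. sqrt (Re z)) as))"
    by (simp add: sv_list_def as(1) proots_prod_linear flip: mset_map)
  show "length (sv_list F) = q" "sorted (rev (sv_list F))" by (simp_all add: sv as)
  show "0 \<le> s" if "s \<in> set (sv_list F)" for s using that ev by (auto simp: sv)
  have "mset (map (\<lambda>s. complex_of_real (s\<^sup>2)) (sv_list F)) =
      mset (map (\<lambda>s. complex_of_real (s\<^sup>2)) (map (\<lambda>z. sqrt (Re z)) as))"
    by (simp only: mset_map sv mset_rev mset_sort)
  also have "map (\<lambda>s. complex_of_real (s\<^sup>2)) (map (\<lambda>z. sqrt (Re z)) as) = as"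
    unfolding map_map
  proof (rule map_idI)
    fix a assume "a \<in> set as"
    from ev[OF this] show "((\<lambda>s. complex_of_real (s\<^sup>2)) \<circ> (\<lambda>z. sqrt (Re z))) a = a" unfolding o_def by blast
  qed
  finally have "mset (map (\<lambda>x. [:- x, 1:]) (map (\<lambda>s. complex_of_real (s\<^sup>2)) (sv_list F))) =
      mset (map (\<lambda>x. [:- x, 1:]) as)"
    by (simp only: mset_map)
  thus "char_poly ?H = (\<Prod>x\<leftarrow>map (\<lambda>s. complex_of_real (s\<^sup>2)) (sv_list F). [:- x, 1:])"
    unfolding as(1) by (metis prod_mset_prod_list)
qed

lemma sv_nonneg [simp]: "0 \<le> sv F i"
proof -
  have "F \<in> carrier_mat (dim_row F) (dim_col F)" by simp
  from sv_list_gram(4)[OF this] show ?thesis by (auto simp: sv_def)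
qed

lemma sv_beyond: "dim_col F < i \<Longrightarrow> sv F i = 0"
  using sv_list_gram(1)[of F "dim_row F" "dim_col F"] by (auto simp: sv_def)

lemma sv_antimono:
  assumes "1 \<le> a" "a \<le> b"
  shows "sv F b \<le> sv F a"
proof (cases "b \<le> length (sv_list F)")
  case True
  have "sorted (rev (sv_list F))" by (rule sv_list_gram(3)[of F "dim_row F" "dim_col F"]) auto
  hence "sv_list F ! (b - 1) \<le> sv_list F ! (a - 1)"
    using assms True by (intro sorted_rev_nth_mono) auto
  thus ?thesis using assms True by (simp add: sv_def)
qed (simp add: sv_def[of F b])

lemma sv_cong_gram: "mat_adjoint F * F = mat_adjoint G * G \<Longrightarrow> sv F = sv G"
  by (rule ext) (simp add: sv_def sv_list_def)

lemma right_singular_basis: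
  assumes F: "F \<in> carrier_mat p q"
  obtains P where "P \<in> carrier_mat q q" "mat_adjoint P * P = 1\<^sub>m q" "P * mat_adjoint P = 1\<^sub>m q"
    "mat_adjoint P * (mat_adjoint F * F) * P = mat_diag q (\<lambda>j. complex_of_real ((sv F (Suc j))\<^sup>2))"
proof -
  from hermitian_diagonalization[OF gram_carrier[OF F] gram_hermitian[OF F] sv_list_gram(2)[OF F]]
  obtain P where P: "P \<in> carrier_mat q q" "mat_adjoint P * P = 1\<^sub>m q" "P * mat_adjoint P = 1\<^sub>m q"
    "mat_adjoint P * (mat_adjoint F * F) * P =
      mat_diag q (\<lambda>i. map (\<lambda>s. complex_of_real (s\<^sup>2)) (sv_list F) ! i)" by auto
  have "mat_diag q (\<lambda>i. map (\<lambda>s. complex_of_real (s\<^sup>2)) (sv_list F) ! i) =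
      mat_diag q (\<lambda>j. complex_of_real ((sv F (Suc j))\<^sup>2))"
    using sv_list_gram(1)[OF F] by (intro eq_matI) (auto simp: mat_diag_def sv_def)
  with P that show ?thesis by metis
qed

lemma nsq_singular_basis:
  assumes F: "F \<in> carrier_mat p q" and P: "P \<in> carrier_mat q q"
    and diag: "mat_adjoint P * (mat_adjoint F * F) * P = mat_diag q (\<lambda>j. complex_of_real (f j))"
    and c: "c \<in> carrier_vec q"
  shows "nsq (F *\<^sub>v (P *\<^sub>v c)) = (\<Sum>j<q. f j * (cmod (c $ j))\<^sup>2)"
proof -
  have "mat_adjoint (F * P) * (F * P) = mat_diag q (\<lambda>j. complex_of_real (f j))"
    using F P by (simp flip: diag add: mat_adjoint_mult[OF F P] mat_mult_assoc)
  from nsq_diag_gram[OF _ c this, of p] F P c show ?thesis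
    by (simp add: mat_vec_assoc)
qed

lemma nsq_le_sv:
  assumes F: "F \<in> carrier_mat p q" and x: "x \<in> carrier_vec q"
  shows "nsq (F *\<^sub>v x) \<le> (sv F 1)\<^sup>2 * nsq x"
proof -
  obtain P where P: "P \<in> carrier_mat q q" "mat_adjoint P * P = 1\<^sub>m q" "P * mat_adjoint P = 1\<^sub>m q"
    "mat_adjoint P * (mat_adjoint F * F) * P = mat_diag q (\<lambda>j. complex_of_real ((sv F (Suc j))\<^sup>2))"
    by (rule right_singular_basis[OF F])
  define c where "c = mat_adjoint P *\<^sub>v x"
  have c: "c \<in> carrier_vec q"
    unfolding c_def by (rule mult_mat_vec_carrier[OF mat_adjoint_carrier[OF P(1)] x])
  have xc: "x = P *\<^sub>v c" using P x by (simp add: c_def flip: mat_vec_assoc)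
  have "nsq (F *\<^sub>v x) = (\<Sum>j<q. (sv F (Suc j))\<^sup>2 * (cmod (c $ j))\<^sup>2)"
    unfolding xc using nsq_singular_basis[OF F P(1,4) c] .
  also have "\<dots> \<le> (\<Sum>j<q. (sv F 1)\<^sup>2 * (cmod (c $ j))\<^sup>2)"
    by (intro sum_mono mult_right_mono power_mono sv_antimono) auto
  also have "\<dots> = (sv F 1)\<^sup>2 * nsq c" using c by (simp add: nsq_def sum_distrib_left)
  also have "nsq c = nsq x" unfolding xc using nsq_isometry[OF P(1,2) c] by simp
  finally show ?thesis .
qed

text \<open>
  Of the \<open>k + i\<close> dimensions of the range of \<open>M\<close>, the constraint \<open>G y = 0\<close> uses up \<open>k\<close> and orthogonality to
  the first \<open>i - 1\<close> right singular vectors of \<open>B\<close> uses up \<open>i - 1\<close>, so a nonzero vector remains.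
  All inequalities between singular values below come from this dimension count.
\<close>

lemma sv_max_min:
  assumes B: "B \<in> carrier_mat p q" and M: "M \<in> carrier_mat q (k + i)"
    and G: "G \<in> carrier_mat k q" and i: "1 \<le> i"
  obtains c where "c \<in> carrier_vec (k + i)" "c \<noteq> 0\<^sub>v (k + i)" "G *\<^sub>v (M *\<^sub>v c) = 0\<^sub>v k"
    "nsq (B *\<^sub>v (M *\<^sub>v c)) \<le> (sv B i)\<^sup>2 * nsq (M *\<^sub>v c)"
proof -
  obtain P where P: "P \<in> carrier_mat q q" "mat_adjoint P * P = 1\<^sub>m q" "P * mat_adjoint P = 1\<^sub>m q"
    "mat_adjoint P * (mat_adjoint B * B) * P = mat_diag q (\<lambda>j. complex_of_real ((sv B (Suc j))\<^sup>2))"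
    by (rule right_singular_basis[OF B])
  define GM where "GM = G * M"
  define PM where "PM = mat_adjoint P * M"
  have GM: "GM \<in> carrier_mat k (k + i)" and PM: "PM \<in> carrier_mat q (k + i)"
    using G M P by (auto simp: GM_def PM_def)
  \<comment> \<open>The two constraints stacked: \<open>k\<close> rows for \<open>G\<close>, then
    \<open>i - 1\<close> rows for the leading right singular vectors, one row fewer than there are
    columns. The zero rows only fill up the case that \<open>i - 1\<close> exceeds
    \<open>q\<close>.\<close>
  define S where "S = mat (k + (i - 1)) (k + i)
    (\<lambda>(r, s). if r < k then GM $$ (r, s) else if r - k < q then PM $$ (r - k, s) else 0)"
  have S: "S \<in> carrier_mat (k + (i - 1)) (k + i)" by (simp add: S_def)
  obtain c where c: "c \<in> carrier_vec (k + i)" "c \<noteq> 0\<^sub>v (k + i)" "S *\<^sub>v c = 0\<^sub>v (k + (i - 1))"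
    using wide_kernel[OF S] i by auto
  have Sc: "row S r \<bullet> c = 0" if "r < k + (i - 1)" for r
    using arg_cong[OF c(3), of "\<lambda>v. v $ r"] that S by simp
  have GMc: "GM *\<^sub>v c = 0\<^sub>v k"
  proof (rule eq_vecI)
    fix r assume "r < dim_vec (0\<^sub>v k :: complex vec)"
    hence r: "r < k" by simp
    moreover have "row GM r = row S r" using r GM by (auto simp: S_def)
    ultimately show "(GM *\<^sub>v c) $ r = 0\<^sub>v k $ r" using Sc[of r] GM by auto
  qed (use GM in auto)
  define y where "y = M *\<^sub>v c"
  have y: "y \<in> carrier_vec q" using M c by (auto simp: y_def)
  define d where "d = PM *\<^sub>v c"
  have d: "d \<in> carrier_vec q" using PM c by (auto simp: d_def)
  have d0: "d $ j = 0" if "j < q" "j < i - 1" for j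
  proof -
    have "row PM j = row S (k + j)" using that PM by (auto simp: S_def)
    thus ?thesis using Sc[of "k + j"] that PM by (auto simp: d_def)
  qed
  have dy: "d = mat_adjoint P *\<^sub>v y"
    using P M c by (simp add: d_def PM_def y_def mat_vec_assoc)
  have yd: "y = P *\<^sub>v d" using P y by (simp add: dy flip: mat_vec_assoc)
  have "nsq (B *\<^sub>v y) = (\<Sum>j<q. (sv B (Suc j))\<^sup>2 * (cmod (d $ j))\<^sup>2)"
    unfolding yd using nsq_singular_basis[OF B P(1,4) d] .
  also have "\<dots> \<le> (\<Sum>j<q. (sv B i)\<^sup>2 * (cmod (d $ j))\<^sup>2)"
  proof (rule sum_mono)
    fix j assume j: "j \<in> {..<q}"
    show "(sv B (Suc j))\<^sup>2 * (cmod (d $ j))\<^sup>2 \<le> (sv B i)\<^sup>2 * (cmod (d $ j))\<^sup>2"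
      using d0[of j] i j
      by (cases "j < i - 1") (auto intro!: mult_right_mono power_mono sv_antimono)
  qed
  also have "\<dots> = (sv B i)\<^sup>2 * nsq d" using d by (simp add: nsq_def sum_distrib_left)
  also have "nsq d = nsq y" unfolding yd using nsq_isometry[OF P(1,2) d] by simp
  finally have "nsq (B *\<^sub>v y) \<le> (sv B i)\<^sup>2 * nsq y" .
  moreover have "G *\<^sub>v y = 0\<^sub>v k"
    using GMc G M c by (simp add: y_def GM_def mat_vec_assoc)
  ultimately show ?thesis using that c y_def by blast
qed

lemma mult_vec_padded:
  assumes P: "P \<in> carrier_mat m q" and "i \<le> q" and c: "(c :: complex vec) \<in> carrier_vec i"
  shows "mat m i (\<lambda>(a, b). P $$ (a, b)) *\<^sub>v c = P *\<^sub>v vec q (\<lambda>j. if j < i then c $ j else 0)"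
proof (rule eq_vecI)
  fix a assume "a < dim_vec (P *\<^sub>v vec q (\<lambda>j. if j < i then c $ j else 0))"
  hence a: "a < m" using P by simp
  have "(\<Sum>j<q. P $$ (a, j) * (if j < i then c $ j else 0)) = (\<Sum>j<i. P $$ (a, j) * c $ j)"
    using \<open>i \<le> q\<close> by (intro sum.mono_neutral_cong_right) auto
  thus "(mat m i (\<lambda>(a, b). P $$ (a, b)) *\<^sub>v c) $ a = (P *\<^sub>v vec q (\<lambda>j. if j < i then c $ j else 0)) $ a"
    using a P c by (simp add: scalar_prod_def atLeast0LessThan)
qed (use P in auto)

text \<open>\<open>M\<close> collects the first \<open>i\<close> right singular vectors, each
  stretched by at least \<open>sv B i\<close>. This is the lower half of the min-max principle;
  \<open>sv_max_min\<close> is the upper half.\<close>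

lemma sv_top_subspace:
  assumes B: "B \<in> carrier_mat p q" and "i \<le> q"
  obtains M where "M \<in> carrier_mat q i" "\<And>c. c \<in> carrier_vec i \<Longrightarrow> nsq (M *\<^sub>v c) = nsq c"
    "\<And>c. c \<in> carrier_vec i \<Longrightarrow> (sv B i)\<^sup>2 * nsq c \<le> nsq (B *\<^sub>v (M *\<^sub>v c))"
proof -
  obtain P where P: "P \<in> carrier_mat q q" "mat_adjoint P * P = 1\<^sub>m q" "P * mat_adjoint P = 1\<^sub>m q"
    "mat_adjoint P * (mat_adjoint B * B) * P = mat_diag q (\<lambda>j. complex_of_real ((sv B (Suc j))\<^sup>2))"
    by (rule right_singular_basis[OF B])
  define M where "M = mat q i (\<lambda>(a, b). P $$ (a, b))"
  define pad :: "complex vec \<Rightarrow> complex vec" where "pad c = vec q (\<lambda>j. if j < i then c $ j else 0)" for c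
  have Mc: "M *\<^sub>v c = P *\<^sub>v pad c" if "c \<in> carrier_vec i" for c
    unfolding M_def pad_def by (rule mult_vec_padded[OF P(1) \<open>i \<le> q\<close> that])
  have pad: "pad c \<in> carrier_vec q" for c by (simp add: pad_def)
  have pad_sum: "(\<Sum>j<q. f j * (cmod (pad c $ j))\<^sup>2) = (\<Sum>j<i. f j * (cmod (c $ j))\<^sup>2)" for f c
    using \<open>i \<le> q\<close> by (intro sum.mono_neutral_cong_right) (auto simp: pad_def)
  show ?thesis
  proof (rule that[of M])
    show "M \<in> carrier_mat q i" by (simp add: M_def)
    fix c :: "complex vec" assume c: "c \<in> carrier_vec i"
    have "nsq (M *\<^sub>v c) = nsq (pad c)" unfolding Mc[OF c] by (rule nsq_isometry[OF P(1,2) pad])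
    also have "\<dots> = nsq c" using pad_sum[of "\<lambda>_. 1" c] c pad[of c] by (simp add: nsq_def)
    finally show "nsq (M *\<^sub>v c) = nsq c" .
    have "(sv B i)\<^sup>2 * nsq c \<le> (\<Sum>j<i. (sv B (Suc j))\<^sup>2 * (cmod (c $ j))\<^sup>2)"
      unfolding nsq_def sum_distrib_left using c
      by (auto intro!: sum_mono mult_right_mono power_mono sv_antimono)
    also have "\<dots> = nsq (B *\<^sub>v (M *\<^sub>v c))"
      unfolding Mc[OF c] nsq_singular_basis[OF B P(1,4) pad] pad_sum ..
    finally show "(sv B i)\<^sup>2 * nsq c \<le> nsq (B *\<^sub>v (M *\<^sub>v c))" .
  qed
qed

text \<open>\<open>B\<close> and \<open>B - L * G\<close> agree on the kernel of \<open>G\<close>.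
  By \<open>sv_max_min\<close>, the span of the \<open>k + i\<close> leading right singular vectors
  of \<open>B\<close> meets this kernel in a vector that \<open>B - L * G\<close> stretches by at
  most its \<open>i\<close>-th singular value.\<close>

lemma sv_low_rank_perturbation:
  assumes B: "B \<in> carrier_mat p q" and L: "L \<in> carrier_mat p k" and G: "G \<in> carrier_mat k q"
    and i: "1 \<le> i"
  shows "sv B (k + i) \<le> sv (B - L * G) i"
proof (cases "k + i \<le> q")
  case True
  obtain M where M: "M \<in> carrier_mat q (k + i)" "\<And>c. c \<in> carrier_vec (k + i) \<Longrightarrow> nsq (M *\<^sub>v c) = nsq c"
    "\<And>c. c \<in> carrier_vec (k + i) \<Longrightarrow> (sv B (k + i))\<^sup>2 * nsq c \<le> nsq (B *\<^sub>v (M *\<^sub>v c))"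
    using sv_top_subspace[OF B True] by blast
  have D: "B - L * G \<in> carrier_mat p q" using B L G by auto
  obtain c where c: "c \<in> carrier_vec (k + i)" "c \<noteq> 0\<^sub>v (k + i)" "G *\<^sub>v (M *\<^sub>v c) = 0\<^sub>v k"
    "nsq ((B - L * G) *\<^sub>v (M *\<^sub>v c)) \<le> (sv (B - L * G) i)\<^sup>2 * nsq (M *\<^sub>v c)"
    using sv_max_min[OF D M(1) G i] by blast
  have y: "M *\<^sub>v c \<in> carrier_vec q" using M(1) c(1) by auto
  have "(B - L * G) *\<^sub>v (M *\<^sub>v c) = B *\<^sub>v (M *\<^sub>v c) - L *\<^sub>v (G *\<^sub>v (M *\<^sub>v c))"
    using B L G y by (simp add: minus_mult_distrib_mat_vec[of _ p q] mat_vec_assoc)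
  also have "L *\<^sub>v (G *\<^sub>v (M *\<^sub>v c)) = 0\<^sub>v p" using L c(3) by auto
  also have "B *\<^sub>v (M *\<^sub>v c) - 0\<^sub>v p = B *\<^sub>v (M *\<^sub>v c)" using B by (intro eq_vecI) auto
  finally have "(sv B (k + i))\<^sup>2 * nsq c \<le> (sv (B - L * G) i)\<^sup>2 * nsq c"
    using M(2,3)[OF c(1)] c(4) by simp
  hence "(sv B (k + i))\<^sup>2 \<le> (sv (B - L * G) i)\<^sup>2" using nsq_pos[OF c(1,2)] by simp
  thus ?thesis by simp
next
  case False
  thus ?thesis using sv_beyond[of B "k + i"] B by simp
qed

lemma sv_zero_mat [simp]: "sv (0\<^sub>m p q) i = 0"
proof (cases "1 \<le> i \<and> i \<le> q")
  case True
  have Z: "0\<^sub>m p q \<in> carrier_mat p q" by simp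
  obtain M where M: "M \<in> carrier_mat q i" "\<And>c. c \<in> carrier_vec i \<Longrightarrow> nsq (M *\<^sub>v c) = nsq c"
    "\<And>c. c \<in> carrier_vec i \<Longrightarrow> (sv (0\<^sub>m p q) i)\<^sup>2 * nsq c \<le> nsq (0\<^sub>m p q *\<^sub>v (M *\<^sub>v c))"
    using sv_top_subspace[OF Z, of i] True by blast
  have u: "unit_vec i 0 \<in> carrier_vec i" by simp
  have "0\<^sub>m p q *\<^sub>v (M *\<^sub>v unit_vec i 0) = 0\<^sub>v p" using M(1) by (intro eq_vecI) auto
  moreover have "nsq (0\<^sub>v p) = 0" by (simp add: nsq_def)
  ultimately have "(sv (0\<^sub>m p q) i)\<^sup>2 * nsq (unit_vec i 0) \<le> 0" using M(3)[OF u] by simp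
  moreover have "0 < nsq (unit_vec i 0)" by (rule nsq_pos[OF u]) (use True in simp)
  ultimately show ?thesis by (simp add: mult_le_0_iff)
next
  case False
  thus ?thesis using sv_beyond[of "0\<^sub>m p q" i] by (cases "i = 0") (auto simp: sv_def)
qed

text \<open>Subtracting \<open>L * G\<close> from itself leaves zero, whose singular values bound
  those of \<open>L * G\<close> past the \<open>k\<close>-th.\<close>

lemma sv_of_low_rank:
  assumes "L \<in> carrier_mat p k" "G \<in> carrier_mat k q" "k < i"
  shows "sv (L * G) i = 0"
proof -
  have "sv (L * G) (k + (i - k)) \<le> sv (L * G - L * G) (i - k)"
    by (rule sv_low_rank_perturbation[OF _ assms(1,2)]) (use assms in auto)
  moreover have "L * G - L * G = 0\<^sub>m p q" using assms by auto
  ultimately show ?thesis using assms(3) sv_nonneg[of "L * G" i] by (simp del: sv_nonneg)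
qed

text \<open>Vectors \<open>z\<close> in the span of the leading eigenvectors of
  \<open>B * mat_adjoint B\<close> supply test vectors \<open>x = mat_adjoint B z\<close>, which
  \<open>B\<close> stretches by at least the \<open>i\<close>-th singular value of
  \<open>mat_adjoint B\<close>. The min-max bound for \<open>B\<close> on these \<open>x\<close>
  gives the inequality without comparing two characteristic polynomials.\<close>

lemma sv_adjoint_le:
  assumes B: "B \<in> carrier_mat p q" and i: "1 \<le> i"
  shows "sv (mat_adjoint B) i \<le> sv B i"
proof (cases "i \<le> p \<and> sv (mat_adjoint B) i \<noteq> 0")
  case True
  let ?s = "sv (mat_adjoint B)"
  have s0: "0 < ?s i" using True sv_nonneg[of "mat_adjoint B" i] by linarith
  have A: "mat_adjoint B \<in> carrier_mat q p" using B by simp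
  obtain P where P: "P \<in> carrier_mat p p" "mat_adjoint P * P = 1\<^sub>m p" "P * mat_adjoint P = 1\<^sub>m p"
    "mat_adjoint P * (mat_adjoint (mat_adjoint B) * mat_adjoint B) * P =
      mat_diag p (\<lambda>j. complex_of_real ((?s (Suc j))\<^sup>2))"
    by (rule right_singular_basis[OF A])
  define Pi where "Pi = mat p i (\<lambda>(a, b). P $$ (a, b))"
  have Pi: "Pi \<in> carrier_mat p i" by (simp add: Pi_def)
  define pad :: "complex vec \<Rightarrow> complex vec" where "pad c = vec p (\<lambda>j. if j < i then c $ j else 0)" for c
  have Pic: "Pi *\<^sub>v c = P *\<^sub>v pad c" if "c \<in> carrier_vec i" for c
    unfolding Pi_def pad_def by (rule mult_vec_padded[OF P(1) _ that]) (use True in auto)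
  have pad: "pad c \<in> carrier_vec p" for c by (simp add: pad_def)
  have M: "mat_adjoint B * Pi \<in> carrier_mat q (0 + i)" using A Pi by auto
  \<comment> \<open>\<open>sv_max_min\<close> with \<open>k = 0\<close>: the constraint matrix has
    no rows.\<close>
  obtain c where c: "c \<in> carrier_vec (0 + i)" "c \<noteq> 0\<^sub>v (0 + i)"
    "nsq (B *\<^sub>v (mat_adjoint B * Pi *\<^sub>v c)) \<le> (sv B i)\<^sup>2 * nsq (mat_adjoint B * Pi *\<^sub>v c)"
    using sv_max_min[OF B M _ i, of "0\<^sub>m 0 q"] by auto
  have ci: "c \<in> carrier_vec i" "c \<noteq> 0\<^sub>v i" using c by auto
  define x where "x = mat_adjoint B *\<^sub>v (P *\<^sub>v pad c)"
  have Mc: "mat_adjoint B * Pi *\<^sub>v c = x"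
    using A Pi ci Pic[OF ci(1)] by (simp add: x_def mat_vec_assoc)
  have nx: "nsq x = (\<Sum>j<p. (?s (Suc j))\<^sup>2 * (cmod (pad c $ j))\<^sup>2)"
    unfolding x_def by (rule nsq_singular_basis[OF A P(1,4) pad])
  define D where "D = mat_diag p (\<lambda>j. complex_of_real ((?s (Suc j))\<^sup>2))"
  have D: "D \<in> carrier_mat p p" by (simp add: D_def)
  have PD: "P * D = B * (mat_adjoint B * P)"
  proof -
    have "P * D = P * (mat_adjoint P * (B * (mat_adjoint B * P)))"
      unfolding D_def P(4)[symmetric] using P(1) A B
      by (simp add: mat_mult_assoc)
    also have "\<dots> = (P * mat_adjoint P) * (B * (mat_adjoint B * P))"
      using P(1) A B by (subst mat_mult_assoc) auto
    also have "\<dots> = B * (mat_adjoint B * P)" using P(1,3) A B by auto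
    finally show ?thesis .
  qed
  have "B *\<^sub>v x = (B * (mat_adjoint B * P)) *\<^sub>v pad c"
    using P(1) A B by (simp add: x_def mat_vec_assoc carrier_vecD[OF pad])
  also have "\<dots> = P *\<^sub>v (D *\<^sub>v pad c)" using P(1) D by (simp add: mat_vec_assoc carrier_vecD[OF pad] flip: PD)
  finally have "nsq (B *\<^sub>v x) = nsq (D *\<^sub>v pad c)"
    using nsq_isometry[OF P(1,2), of "D *\<^sub>v pad c"] D pad[of c] by auto
  also have "\<dots> = (\<Sum>j<p. ((?s (Suc j))\<^sup>2)\<^sup>2 * (cmod (pad c $ j))\<^sup>2)"
  proof (rule nsq_diag_gram[OF D pad])
    show "mat_adjoint D * D = mat_diag p (\<lambda>j. complex_of_real (((?s (Suc j))\<^sup>2)\<^sup>2))"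
    proof -
      have "mat_adjoint D = D" by (rule eq_matI) (auto simp: D_def mat_diag_def)
      thus ?thesis unfolding D_def by (simp add: power2_eq_square)
    qed
  qed
  finally have nBx: "nsq (B *\<^sub>v x) = (\<Sum>j<p. ((?s (Suc j))\<^sup>2)\<^sup>2 * (cmod (pad c $ j))\<^sup>2)" .
  \<comment> \<open>Applying \<open>B\<close> after \<open>mat_adjoint B\<close> raises the weights
    from \<open>s^2\<close> to \<open>s^4\<close>. On indices below \<open>i\<close> the extra
    factor is at least the square of \<open>?s i\<close>; elsewhere the padding is zero.\<close>
  have term_le: "(?s i)\<^sup>2 * (?s (Suc j))\<^sup>2 * (cmod (pad c $ j))\<^sup>2 \<le> ((?s (Suc j))\<^sup>2)\<^sup>2 * (cmod (pad c $ j))\<^sup>2"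
    if "j < p" for j
  proof (cases "j < i")
    case True
    hence "(?s i)\<^sup>2 * (?s (Suc j))\<^sup>2 \<le> (?s (Suc j))\<^sup>2 * (?s (Suc j))\<^sup>2"
      by (intro mult_right_mono power_mono sv_antimono) auto
    thus ?thesis by (simp add: power2_eq_square mult_right_mono)
  qed (use that in \<open>simp add: pad_def\<close>)
  have "(?s i)\<^sup>2 * nsq x \<le> nsq (B *\<^sub>v x)"
    unfolding nx nBx sum_distrib_left using term_le by (auto intro!: sum_mono simp: mult.assoc)
  hence le: "(?s i)\<^sup>2 * nsq x \<le> (sv B i)\<^sup>2 * nsq x" using c(3) Mc by simp
  have "(?s i)\<^sup>2 * nsq c \<le> nsq x"
  proof -
    have "(?s i)\<^sup>2 * nsq c = (\<Sum>j<i. (?s i)\<^sup>2 * (cmod (c $ j))\<^sup>2)"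
      using ci by (simp add: nsq_def sum_distrib_left)
    also have "\<dots> \<le> (\<Sum>j<i. (?s (Suc j))\<^sup>2 * (cmod (pad c $ j))\<^sup>2)"
      using True by (auto intro!: sum_mono mult_mono power_mono sv_antimono simp: pad_def)
    also have "\<dots> \<le> nsq x"
      unfolding nx using True by (intro sum_mono2) auto
    finally show ?thesis .
  qed
  \<comment> \<open>A positive \<open>?s i\<close> keeps \<open>x\<close> from vanishing, so that
    \<open>nsq x\<close> can be cancelled.\<close>
  hence "0 < nsq x" using s0 nsq_pos[OF ci] by (smt (verit) mult_pos_pos zero_less_power)
  hence "(?s i)\<^sup>2 \<le> (sv B i)\<^sup>2" using le by simp
  thus ?thesis by simp
next
  case False
  thus ?thesis using sv_beyond[of "mat_adjoint B" i] B by fastforce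
qed

lemma sv_adjoint:
  assumes "1 \<le> i"
  shows "sv (mat_adjoint B) i = sv B i"
  using sv_adjoint_le[of B "dim_row B" "dim_col B" i]
    sv_adjoint_le[of "mat_adjoint B" "dim_col B" "dim_row B" i] assms
  by (simp add: antisym)

text \<open>If the value vanished, some nonzero \<open>y\<close> in the span of the leading
  \<open>i\<close> right singular vectors of \<open>B\<close> would satisfy
  \<open>B y = - E y\<close>, although \<open>B\<close> stretches \<open>y\<close> by at least
  \<open>sv B i\<close> and \<open>E\<close> by at most \<open>sv E 1\<close>.\<close>

lemma sv_perturbed_pos:
  assumes B: "B \<in> carrier_mat p q" and E: "E \<in> carrier_mat p q" and i: "1 \<le> i"
    and less: "sv E 1 < sv B i"
  shows "0 < sv (B + E) i"
proof (rule ccontr)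
  assume "\<not> 0 < sv (B + E) i"
  hence 0: "sv (B + E) i = 0" using sv_nonneg[of "B + E" i] by linarith
  have "i \<le> q"
  proof (rule ccontr)
    assume "\<not> i \<le> q"
    hence "sv B i = 0" using B by (intro sv_beyond) simp
    thus False using less sv_nonneg[of E 1] by linarith
  qed
  then obtain M where M: "M \<in> carrier_mat q i" "\<And>c. c \<in> carrier_vec i \<Longrightarrow> nsq (M *\<^sub>v c) = nsq c"
    "\<And>c. c \<in> carrier_vec i \<Longrightarrow> (sv B i)\<^sup>2 * nsq c \<le> nsq (B *\<^sub>v (M *\<^sub>v c))"
    using sv_top_subspace[OF B] by blast
  have D: "B + E \<in> carrier_mat p q" using B E by auto
  obtain c where c: "c \<in> carrier_vec i" "c \<noteq> 0\<^sub>v i"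
    "nsq ((B + E) *\<^sub>v (M *\<^sub>v c)) \<le> (sv (B + E) i)\<^sup>2 * nsq (M *\<^sub>v c)"
    using sv_max_min[OF D, of M 0 i "0\<^sub>m 0 q"] M(1) i by auto
  define y where "y = M *\<^sub>v c"
  have y: "y \<in> carrier_vec q" using M(1) c(1) by (auto simp: y_def)
  have "nsq ((B + E) *\<^sub>v y) = 0" using c(3) nsq_nonneg[of "(B + E) *\<^sub>v y"] by (intro antisym) (simp_all add: 0 y_def)
  hence "(B + E) *\<^sub>v y = 0\<^sub>v p" using nsq_eq_0[of "(B + E) *\<^sub>v y" p] D y by auto
  hence sum0: "B *\<^sub>v y + E *\<^sub>v y = 0\<^sub>v p" using B E y by (simp add: add_mult_distrib_mat_vec[of _ p q])
  have "(B *\<^sub>v y) $ j = - (E *\<^sub>v y) $ j" if "j < p" for j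
    using arg_cong[OF sum0, of "\<lambda>v. v $ j"] that B E by (simp add: eq_neg_iff_add_eq_0)
  hence "nsq (B *\<^sub>v y) = nsq (E *\<^sub>v y)" using B E by (simp add: nsq_def)
  hence "(sv B i)\<^sup>2 * nsq c \<le> (sv E 1)\<^sup>2 * nsq c"
    using M(2,3)[OF c(1)] nsq_le_sv[OF E y] by (simp add: y_def)
  hence "(sv B i)\<^sup>2 \<le> (sv E 1)\<^sup>2" using nsq_pos[OF c(1,2)] by simp
  thus False using less by simp
qed

section \<open>Pseudoinverses and rank\<close>

lemma is_pinvD:
  assumes "is_pinv B X"
  shows "dim_row X = dim_col B" "dim_col X = dim_row B" "B * X * B = B" "X * B * X = X"
    "mat_adjoint (B * X) = B * X" "mat_adjoint (X * B) = X * B"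
  using assms by (auto simp: is_pinv_def)

text \<open>\<open>B * X\<close> and \<open>B * Y\<close> are both the orthogonal projection onto
  the range of \<open>B\<close>, so they coincide, and likewise \<open>X * B\<close> and
  \<open>Y * B\<close>. Then \<open>X = X B X = Y B X = Y B Y = Y\<close>.\<close>

lemma is_pinv_unique:
  assumes X: "is_pinv B X" and Y: "is_pinv B Y"
  shows "X = Y"
proof -
  note x = is_pinvD[OF X] and y = is_pinvD[OF Y]
  have BX: "B * X = B * Y"
  proof -
    have "B * X = (B * Y) * (B * X)" using x(1,2) y(1-3) by (simp flip: mat_mult_assoc)
    also have "\<dots> = mat_adjoint (B * X * (B * Y))"
      using x(1,2,5) y(1,2,5) by (simp add: mat_adjoint_times[of "B * X"])
    also have "B * X * (B * Y) = B * Y" using x(1-3) y(1,2) by (simp flip: mat_mult_assoc)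
    finally show ?thesis using y(5) by simp
  qed
  have XB: "X * B = Y * B"
  proof -
    have "X * B = (X * B) * (Y * B)" using x(1,2) y(1-3) by (simp add: mat_mult_assoc)
    also have "\<dots> = mat_adjoint (Y * B * (X * B))"
      using x(1,2,6) y(1,2,6) by (simp add: mat_adjoint_times[of "Y * B"])
    also have "Y * B * (X * B) = Y * B" using x(1-3) y(1,2) by (simp add: mat_mult_assoc)
    finally show ?thesis using y(6) by simp
  qed
  have "X = (X * B) * X" using x by simp
  also have "\<dots> = Y * (B * X)" unfolding XB using x y by (simp add: mat_mult_assoc)
  also have "\<dots> = Y" unfolding BX using x y by (simp flip: mat_mult_assoc)
  finally show ?thesis .
qed

lemma pinv_eqI: "is_pinv B X \<Longrightarrow> pinv B = X"
  unfolding pinv_def using is_pinv_unique by blast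

lemma is_pinv_pinv: "is_pinv B X \<Longrightarrow> is_pinv B (pinv B)"
  using pinv_eqI by blast

section \<open>Full column rank and existence of pseudoinverses\<close>

text \<open>Full column rank, stated through the kernel: this form follows from lower bounds on
  lengths and clashes directly with \<open>wide_kernel\<close>.\<close>

definition injective_mat :: "complex mat \<Rightarrow> bool" where
  "injective_mat F \<longleftrightarrow> (\<forall>x\<in>carrier_vec (dim_col F). F *\<^sub>v x = 0\<^sub>v (dim_row F) \<longrightarrow> x = 0\<^sub>v (dim_col F))"

text \<open>\<open>L\<close> is the inverse of the Gram matrix times \<open>mat_adjoint F\<close>.
  The Gram matrix is injective because its quadratic form at \<open>x\<close> is
  \<open>nsq (F x)\<close>; its inverse is Hermitian, hence so is \<open>F * L\<close>.\<close>

lemma injective_mat_left_inverse: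
  assumes F: "F \<in> carrier_mat m k" and inj: "injective_mat F"
  obtains L where "L \<in> carrier_mat k m" "L * F = 1\<^sub>m k" "mat_adjoint (F * L) = F * L"
proof -
  define G where "G = mat_adjoint F * F"
  have G: "G \<in> carrier_mat k k" using gram_carrier[OF F] by (simp add: G_def)
  have Gadj: "mat_adjoint G = G" using gram_hermitian[OF F] by (simp add: G_def)
  have "x = 0\<^sub>v k" if x: "x \<in> carrier_vec k" "G *\<^sub>v x = 0\<^sub>v k" for x
  proof -
    have "complex_of_real (nsq (F *\<^sub>v x)) = 0"
      unfolding nsq_mult_mat_vec[OF F x(1)] using x by (simp flip: G_def)
    hence "F *\<^sub>v x = 0\<^sub>v m" using nsq_eq_0[of "F *\<^sub>v x" m] F x by auto
    thus ?thesis using inj F x(1) by (auto simp: injective_mat_def)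
  qed
  then obtain G' where G': "G' \<in> carrier_mat k k" "G' * G = 1\<^sub>m k" "G * G' = 1\<^sub>m k"
    using injective_square_inverse[OF G] by blast
  have "G * mat_adjoint G' = 1\<^sub>m k"
    using arg_cong[OF G'(2), of mat_adjoint] G G'(1) Gadj by (simp add: mat_adjoint_times)
  hence "(G' * G) * mat_adjoint G' = G'" using G G'(1) by (simp add: mat_mult_assoc)
  hence G'adj: "mat_adjoint G' = G'" using G'(1,2) by simp
  show ?thesis
  proof (rule that[of "G' * mat_adjoint F"])
    show "G' * mat_adjoint F \<in> carrier_mat k m" using F G'(1) by (intro carrier_matI) auto
    show "G' * mat_adjoint F * F = 1\<^sub>m k" using F G' by (simp add: mat_mult_assoc flip: G_def)
    show "mat_adjoint (F * (G' * mat_adjoint F)) = F * (G' * mat_adjoint F)"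
      using F G' G'adj by (simp add: mat_adjoint_times mat_mult_assoc)
  qed
qed

lemma is_pinv_left_inverse:
  assumes "F \<in> carrier_mat m k" "L \<in> carrier_mat k m" "L * F = 1\<^sub>m k" "mat_adjoint (F * L) = F * L"
  shows "is_pinv F L"
  using assms unfolding is_pinv_def by (auto simp: mat_mult_assoc)

lemma pinv_injective_mat:
  assumes F: "F \<in> carrier_mat m k" and inj: "injective_mat F"
  shows "is_pinv F (pinv F)" "pinv F * F = 1\<^sub>m k"
proof -
  obtain L where L: "L \<in> carrier_mat k m" "L * F = 1\<^sub>m k" "mat_adjoint (F * L) = F * L"
    by (rule injective_mat_left_inverse[OF F inj])
  have "is_pinv F L" using is_pinv_left_inverse[OF F L] .
  thus "is_pinv F (pinv F)" "pinv F * F = 1\<^sub>m k" using pinv_eqI is_pinv_pinv L(2) by auto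
qed

text \<open>With left inverses \<open>L\<close> of \<open>F\<close> and \<open>R\<close> of
  \<open>H\<close>, the matrix \<open>mat_adjoint R * L\<close> solves the Penrose equations, as the
  inner factors cancel. A solution must be exhibited because \<open>pinv\<close> is a definite
  description.\<close>

lemma is_pinv_full_rank_factorization:
  assumes F: "F \<in> carrier_mat p k" "injective_mat F" and H: "H \<in> carrier_mat q k" "injective_mat H"
  shows "is_pinv (F * mat_adjoint H) (pinv (F * mat_adjoint H))"
proof -
  obtain L where L: "L \<in> carrier_mat k p" "L * F = 1\<^sub>m k" "mat_adjoint (F * L) = F * L"
    by (rule injective_mat_left_inverse[OF F])
  obtain R where R: "R \<in> carrier_mat k q" "R * H = 1\<^sub>m k" "mat_adjoint (H * R) = H * R"
    by (rule injective_mat_left_inverse[OF H])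
  have HR: "mat_adjoint H * mat_adjoint R = 1\<^sub>m k"
    using arg_cong[OF R(2), of mat_adjoint] R(1) H(1) by (simp add: mat_adjoint_times)
  define U where "U = F * mat_adjoint H"
  define X where "X = mat_adjoint R * L"
  have U: "U \<in> carrier_mat p q" using F H by (auto simp: U_def intro!: carrier_matI)
  have X: "X \<in> carrier_mat q p" using L R by (auto simp: X_def intro!: carrier_matI)
  have UX: "U * X = F * L"
  proof -
    have "U * X = F * ((mat_adjoint H * mat_adjoint R) * L)"
      using F(1) H(1) L(1) R(1) by (simp add: U_def X_def mat_mult_assoc)
    thus ?thesis using L(1) by (simp add: HR)
  qed
  have XU: "X * U = mat_adjoint R * mat_adjoint H"
  proof -
    have "X * U = mat_adjoint R * ((L * F) * mat_adjoint H)"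
      using F(1) H(1) L(1) R(1) by (simp add: U_def X_def mat_mult_assoc)
    thus ?thesis using H(1) by (simp add: L(2))
  qed
  have UXU: "U * X * U = U"
  proof -
    have "U * X * U = F * ((L * F) * mat_adjoint H)"
      unfolding UX using F(1) H(1) L(1) by (simp add: U_def mat_mult_assoc)
    thus ?thesis using H(1) by (simp add: L(2) U_def)
  qed
  have XUX: "X * U * X = X"
  proof -
    have "X * U * X = mat_adjoint R * ((mat_adjoint H * mat_adjoint R) * L)"
      unfolding XU using R(1) H(1) L(1) by (simp add: X_def mat_mult_assoc)
    thus ?thesis using L(1) by (simp add: HR X_def)
  qed
  have "mat_adjoint (X * U) = X * U"
    unfolding XU using R H by (simp add: mat_adjoint_times)
  hence "is_pinv U X" using U X UXU XUX UX L(3) by (auto simp: is_pinv_def)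
  thus ?thesis unfolding U_def by (rule is_pinv_pinv)
qed

section \<open>Rank and factorizations through few dimensions\<close>

text \<open>Brings the library rank, the size of a maximal independent set of columns, into matrix
  form: \<open>L\<close> lists such a set.\<close>

lemma mat_rank_column_basis:
  assumes A: "A \<in> carrier_mat m n"
  obtains L where "L \<in> carrier_mat m (mat_rank A)" "injective_mat L" "set (cols L) \<subseteq> set (cols A)"
    "\<And>x. x \<in> set (cols A) \<Longrightarrow> \<exists>g\<in>carrier_vec (mat_rank A). x = L *\<^sub>v g"
proof -
  interpret vec_space "TYPE(complex)" m .
  obtain S where S: "finite S" "maximal S (\<lambda>T. T \<subseteq> set (cols A) \<and> lin_indpt T)"
    using maximal_exists_superset[of "set (cols A)" "\<lambda>T. T \<subseteq> set (cols A) \<and> lin_indpt T" "{}"]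
    by (auto simp: lin_dep_def)
  have rank: "mat_rank A = card S" using rank_card_indpt[OF A S(2)] A by (simp add: mat_rank_def)
  have cA: "set (cols A) \<subseteq> carrier_vec m" using cols_dim[of A] A by auto
  have SA: "S \<subseteq> set (cols A)" and indep: "lin_indpt S" using S(2) by (auto simp: maximal_def)
  have Sc: "S \<subseteq> carrier_vec m" using SA cA by auto
  obtain xs where xs: "set xs = S" "distinct xs" using finite_distinct_list[OF S(1)] by auto
  have len: "length xs = mat_rank A" using xs rank distinct_card by metis
  define L where "L = mat_of_cols m xs"
  have L: "L \<in> carrier_mat m (mat_rank A)" using mat_of_cols_carrier(1)[of m xs] by (simp only: L_def len)
  have colsL: "cols L = xs" unfolding L_def using xs Sc by (intro cols_mat_of_cols) auto
  show ?thesis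
  proof (rule that[OF L])
    show "injective_mat L"
      unfolding injective_mat_def
    proof (intro ballI impI, rule ccontr)
      fix x assume x: "x \<in> carrier_vec (dim_col L)" "L *\<^sub>v x = 0\<^sub>v (dim_row L)" "x \<noteq> 0\<^sub>v (dim_col L)"
      have "lin_dep (set (cols L))"
        by (rule lin_depI[OF L, of x]) (use x L colsL xs in auto)
      thus False using indep colsL xs by simp
    qed
    show "set (cols L) \<subseteq> set (cols A)" using colsL xs SA by simp
    fix x assume x: "x \<in> set (cols A)"
    have "x \<in> span S"
    proof (rule ccontr)
      assume nx: "x \<notin> span S"
      have "lin_indpt (S \<union> {x})"
        using lin_dep_iff_in_span[OF Sc indep _ ] nx x cA in_own_span[OF Sc] by blast
      hence "S \<union> {x} = S" using S(2) x SA unfolding maximal_def by blast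
      thus False using nx in_own_span[OF Sc] by auto
    qed
    then obtain a where "x = lincomb a S" using finite_in_span[OF S(1) Sc] by blast
    hence "x = L *\<^sub>v vec (mat_rank A) (\<lambda>i. a (col L i))"
      using mat_mult_eq_lincomb[OF L, of a] colsL xs by simp
    thus "\<exists>g\<in>carrier_vec (mat_rank A). x = L *\<^sub>v g" by (rule bexI) simp
  qed
qed

lemma factor_through_columns:
  fixes A L :: "complex mat"
  assumes A: "A \<in> carrier_mat m n" and L: "L \<in> carrier_mat m k"
    and cols: "\<And>x. x \<in> set (cols A) \<Longrightarrow> \<exists>g\<in>carrier_vec k. x = L *\<^sub>v g"
  obtains G where "G \<in> carrier_mat k n" "A = L * G"
proof -
  have "\<exists>g\<in>carrier_vec k. col A j = L *\<^sub>v g" if "j < n" for j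
    using cols[of "col A j"] A that by (auto simp: cols_def)
  then obtain g where g: "\<And>j. j < n \<Longrightarrow> g j \<in> carrier_vec k \<and> col A j = L *\<^sub>v g j" by metis
  define G where "G = mat k n (\<lambda>(i,j). g j $ i)"
  have G: "G \<in> carrier_mat k n" by (simp add: G_def)
  have cG: "col G j = g j" if "j < n" for j using g[OF that] that by (auto simp: G_def)
  have "A = L * G"
  proof (rule eq_matI)
    fix i j assume "i < dim_row (L * G)" "j < dim_col (L * G)"
    hence ij: "i < m" "j < n" using L G by auto
    have "A $$ (i,j) = col A j $ i" using ij A by simp
    also have "\<dots> = (L * G) $$ (i,j)" using g[OF ij(2)] ij L G cG[OF ij(2)] by simp
    finally show "A $$ (i,j) = (L * G) $$ (i,j)" .
  qed (use A L G in auto)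
  with G that show ?thesis by blast
qed

lemma rank_factorization:
  assumes A: "A \<in> carrier_mat m n"
  obtains L G where "L \<in> carrier_mat m (mat_rank A)" "G \<in> carrier_mat (mat_rank A) n" "A = L * G"
proof -
  obtain L where L: "L \<in> carrier_mat m (mat_rank A)"
    "\<And>x. x \<in> set (cols A) \<Longrightarrow> \<exists>g\<in>carrier_vec (mat_rank A). x = L *\<^sub>v g"
    by (rule mat_rank_column_basis[OF A]) blast
  obtain G where "G \<in> carrier_mat (mat_rank A) n" "A = L * G"
    by (rule factor_through_columns[OF A L])
  with L(1) show ?thesis by (rule that)
qed

text \<open>Independent columns of \<open>L * G\<close> factor as \<open>M = L * G'\<close>. If
  there were more than \<open>k\<close> of them, \<open>G'\<close> would be wide and its kernel
  would contradict the injectivity of \<open>M\<close>.\<close>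

lemma mat_rank_mult_le:
  assumes L: "L \<in> carrier_mat m k" and G: "G \<in> carrier_mat k n"
  shows "mat_rank (L * G) \<le> k"
proof (rule ccontr)
  assume "\<not> mat_rank (L * G) \<le> k"
  hence lt: "k < mat_rank (L * G)" by simp
  have LG: "L * G \<in> carrier_mat m n" using L G by auto
  obtain M where M: "M \<in> carrier_mat m (mat_rank (L * G))" "injective_mat M"
    "set (cols M) \<subseteq> set (cols (L * G))"
    by (rule mat_rank_column_basis[OF LG])
  have "\<exists>g\<in>carrier_vec k. x = L *\<^sub>v g" if "x \<in> set (cols M)" for x
  proof -
    from that M(3) obtain j where j: "j < n" "x = col (L * G) j" using LG L G by (auto simp: cols_def)
    hence "x = L *\<^sub>v col G j" using col_mult2[OF L G] by (simp only:)
    thus ?thesis using G j by (intro bexI[of _ "col G j"]) auto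
  qed
  then obtain G' where G': "G' \<in> carrier_mat k (mat_rank (L * G))" "M = L * G'"
    by (rule factor_through_columns[OF M(1) L])
  obtain x where x: "x \<in> carrier_vec (mat_rank (L * G))" "x \<noteq> 0\<^sub>v (mat_rank (L * G))" "G' *\<^sub>v x = 0\<^sub>v k"
    using wide_kernel[OF G'(1) lt] by auto
  have "M *\<^sub>v x = L *\<^sub>v (G' *\<^sub>v x)" using L G' x by (simp add: mat_vec_assoc)
  also have "\<dots> = 0\<^sub>v m" using x(3) L by auto
  finally show False using M(1,2) x by (auto simp: injective_mat_def)
qed

text \<open>A factorization through \<open>r < k\<close> dimensions, multiplied by one-sided
  inverses of \<open>F\<close> and \<open>mat_adjoint H\<close>, would factor the identity of size
  \<open>k\<close> through \<open>r\<close> dimensions.\<close>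

lemma mat_rank_full_rank_factorization:
  assumes F: "F \<in> carrier_mat p k" "injective_mat F" and H: "H \<in> carrier_mat q k" "injective_mat H"
  shows "mat_rank (F * mat_adjoint H) = k"
proof (rule antisym)
  show "mat_rank (F * mat_adjoint H) \<le> k" using F H by (intro mat_rank_mult_le) auto
  show "k \<le> mat_rank (F * mat_adjoint H)"
  proof (rule ccontr)
    define U where "U = F * mat_adjoint H"
    define r where "r = mat_rank U"
    assume "\<not> k \<le> mat_rank (F * mat_adjoint H)"
    hence r: "r < k" by (simp add: r_def U_def)
    have "U \<in> carrier_mat p q" using F H by (auto simp: U_def intro!: carrier_matI)
    then obtain L G where LG: "L \<in> carrier_mat p r" "G \<in> carrier_mat r q" "U = L * G"
      unfolding r_def by (rule rank_factorization)
    obtain F' where F': "F' \<in> carrier_mat k p" "F' * F = 1\<^sub>m k"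
      by (rule injective_mat_left_inverse[OF F])
    obtain H' where H': "H' \<in> carrier_mat k q" "H' * H = 1\<^sub>m k"
      by (rule injective_mat_left_inverse[OF H])
    have HH: "mat_adjoint H * mat_adjoint H' = 1\<^sub>m k"
      using arg_cong[OF H'(2), of mat_adjoint] H'(1) H(1) by (simp add: mat_adjoint_times)
    have GH: "G * mat_adjoint H' \<in> carrier_mat r k" using LG H' by (auto intro!: carrier_matI)
    obtain x where x: "x \<in> carrier_vec k" "x \<noteq> 0\<^sub>v k" "(G * mat_adjoint H') *\<^sub>v x = 0\<^sub>v r"
      using wide_kernel[OF GH r] by auto
    have "x = ((F' * F) * (mat_adjoint H * mat_adjoint H')) *\<^sub>v x" using F'(2) HH x(1) by simp
    also have "(F' * F) * (mat_adjoint H * mat_adjoint H') = F' * (U * mat_adjoint H')"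
      using F(1) H(1) F'(1) H'(1) by (simp add: U_def mat_mult_assoc)
    also have "\<dots> = F' * (L * (G * mat_adjoint H'))" unfolding LG(3) using LG H' F' by (simp add: mat_mult_assoc)
    also have "\<dots> *\<^sub>v x = F' *\<^sub>v (L *\<^sub>v ((G * mat_adjoint H') *\<^sub>v x))"
      using F'(1) LG(1,2) H'(1) x(1) by (simp add: mat_vec_assoc)
    also have "L *\<^sub>v ((G * mat_adjoint H') *\<^sub>v x) = 0\<^sub>v p" unfolding x(3) using LG(1) by auto
    also have "F' *\<^sub>v 0\<^sub>v p = 0\<^sub>v k" using F'(1) by auto
    finally show False using x(2) by simp
  qed
qed

text \<open>A positive \<open>k\<close>-th singular value makes \<open>F * G\<close> injective on a
  \<open>k\<close>-dimensional space, the range of \<open>M\<close>. Then \<open>T = G * M\<close>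
  is injective and square, hence onto, and injectivity of \<open>F * T\<close> passes to
  \<open>F\<close>.\<close>

lemma injective_left_factor:
  assumes F: "F \<in> carrier_mat p k" and G: "G \<in> carrier_mat k q" and pos: "0 < sv (F * G) k"
  shows "injective_mat F"
proof -
  define U where "U = F * G"
  have U: "U \<in> carrier_mat p q" using F G by (auto simp: U_def)
  have "k \<le> q"
  proof (rule ccontr)
    assume "\<not> k \<le> q"
    hence "sv U k = 0" using U by (intro sv_beyond) simp
    thus False using pos by (simp add: U_def)
  qed
  then obtain M where M: "M \<in> carrier_mat q k" "\<And>c. c \<in> carrier_vec k \<Longrightarrow> nsq (M *\<^sub>v c) = nsq c"
    "\<And>c. c \<in> carrier_vec k \<Longrightarrow> (sv U k)\<^sup>2 * nsq c \<le> nsq (U *\<^sub>v (M *\<^sub>v c))"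
    using sv_top_subspace[OF U] by metis
  define T where "T = G * M"
  have T: "T \<in> carrier_mat k k" using G M by (auto simp: T_def)
  have UM: "U *\<^sub>v (M *\<^sub>v c) = F *\<^sub>v (T *\<^sub>v c)" if "c \<in> carrier_vec k" for c
    using F G M(1) that by (simp add: U_def T_def mat_vec_assoc)
  have 0: "c = 0\<^sub>v k" if c: "c \<in> carrier_vec k" "F *\<^sub>v (T *\<^sub>v c) = 0\<^sub>v p" for c
  proof (rule ccontr)
    assume "c \<noteq> 0\<^sub>v k"
    hence "0 < (sv U k)\<^sup>2 * nsq c" using nsq_pos[OF c(1)] pos by (simp add: U_def)
    also have "\<dots> \<le> nsq (0\<^sub>v p)" using M(3)[OF c(1)] UM[OF c(1)] c(2) by simp
    finally show False by (simp add: nsq_def)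
  qed
  have F0: "F *\<^sub>v 0\<^sub>v k = 0\<^sub>v p" using F by auto
  have "c = 0\<^sub>v k" if "c \<in> carrier_vec k" "T *\<^sub>v c = 0\<^sub>v k" for c
    using 0[OF that(1)] that(2) F0 by simp
  then obtain T' where T': "T' \<in> carrier_mat k k" "T' * T = 1\<^sub>m k" "T * T' = 1\<^sub>m k"
    using injective_square_inverse[OF T] by metis
  show ?thesis unfolding injective_mat_def
  proof (intro ballI impI)
    fix x assume x: "x \<in> carrier_vec (dim_col F)" "F *\<^sub>v x = 0\<^sub>v (dim_row F)"
    hence xk: "x \<in> carrier_vec k" using F by simp
    have TT: "T *\<^sub>v (T' *\<^sub>v x) = x" using T T' xk by (simp flip: mat_vec_assoc)
    hence "T' *\<^sub>v x = 0\<^sub>v k" using 0[of "T' *\<^sub>v x"] T' xk x(2) F by auto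
    hence "x = T *\<^sub>v 0\<^sub>v k" using TT by simp
    thus "x = 0\<^sub>v (dim_col F)" using T F by auto
  qed
qed

lemma injective_factors:
  assumes F: "F \<in> carrier_mat p k" and H: "H \<in> carrier_mat q k" and "1 \<le> k"
    and pos: "0 < sv (F * mat_adjoint H) k"
  shows "injective_mat F" "injective_mat H"
proof -
  show "injective_mat F" using injective_left_factor[OF F mat_adjoint_carrier[OF H] pos] .
  have "0 < sv (H * mat_adjoint F) k"
    using pos sv_adjoint[OF \<open>1 \<le> k\<close>, of "F * mat_adjoint H"] F H by (simp add: mat_adjoint_times)
  thus "injective_mat H" using injective_left_factor[OF H mat_adjoint_carrier[OF F]] by blast
qed

section \<open>The spectral norm of a pseudoinverse\<close>

text \<open>A vector in the range of \<open>mat_adjoint U\<close> is orthogonal to the kernel of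
  \<open>U\<close>. That kernel contains all right singular vectors after the \<open>k\<close>-th,
  so only directions stretched by at least \<open>sv U k\<close> remain.\<close>

lemma nsq_ge_sv_on_row_space:
  assumes U: "U \<in> carrier_mat p q" and z: "z \<in> carrier_vec p" and 0: "sv U (Suc k) = 0"
  shows "(sv U k)\<^sup>2 * nsq (mat_adjoint U *\<^sub>v z) \<le> nsq (U *\<^sub>v (mat_adjoint U *\<^sub>v z))"
proof -
  define y where "y = mat_adjoint U *\<^sub>v z"
  have y: "y \<in> carrier_vec q" using mult_mat_vec_carrier[OF mat_adjoint_carrier[OF U] z] by (simp add: y_def)
  obtain P where P: "P \<in> carrier_mat q q" "mat_adjoint P * P = 1\<^sub>m q" "P * mat_adjoint P = 1\<^sub>m q"
    "mat_adjoint P * (mat_adjoint U * U) * P = mat_diag q (\<lambda>j. complex_of_real ((sv U (Suc j))\<^sup>2))"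
    by (rule right_singular_basis[OF U])
  define c where "c = mat_adjoint P *\<^sub>v y"
  have c: "c \<in> carrier_vec q" using mult_mat_vec_carrier[OF mat_adjoint_carrier[OF P(1)] y] by (simp add: c_def)
  have yc: "y = P *\<^sub>v c" using P y by (simp add: c_def flip: mat_vec_assoc)
  have c0: "c $ j = 0" if j: "j < q" "k \<le> j" for j
  proof -
    let ?u = "unit_vec q j :: complex vec"
    have Pu: "P *\<^sub>v ?u \<in> carrier_vec q" using P(1) by auto
    have "sv U (Suc j) \<le> 0" using sv_antimono[of "Suc k" "Suc j" U] j 0 by simp
    hence s0: "sv U (Suc j) = 0" using sv_nonneg[of U "Suc j"] by linarith
    have "nsq (U *\<^sub>v (P *\<^sub>v ?u)) = (\<Sum>i<q. (sv U (Suc i))\<^sup>2 * (cmod (?u $ i))\<^sup>2)"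
      by (rule nsq_singular_basis[OF U P(1,4)]) simp
    also have "\<dots> = 0" using s0 j by (intro sum.neutral) (auto simp: unit_vec_def)
    finally have UPu: "U *\<^sub>v (P *\<^sub>v ?u) = 0\<^sub>v p" using nsq_eq_0[of "U *\<^sub>v (P *\<^sub>v ?u)" p] U Pu by auto
    have "c \<bullet>c ?u = y \<bullet>c (P *\<^sub>v ?u)"
      unfolding c_def using cscalar_prod_adjoint[OF mat_adjoint_carrier[OF P(1)] y, of ?u] by simp
    also have "\<dots> = z \<bullet>c (U *\<^sub>v (P *\<^sub>v ?u))"
      unfolding y_def using cscalar_prod_adjoint[OF mat_adjoint_carrier[OF U] z Pu] by simp
    also have "\<dots> = 0" unfolding UPu using z by simp
    finally show ?thesis using c j by (simp add: scalar_prod_def unit_vec_def if_distrib cong: if_cong)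
  qed
  have "(sv U k)\<^sup>2 * nsq y = (sv U k)\<^sup>2 * nsq c" unfolding yc using nsq_isometry[OF P(1,2) c] by simp
  also have "\<dots> = (\<Sum>j<q. (sv U k)\<^sup>2 * (cmod (c $ j))\<^sup>2)" using c by (simp add: nsq_def sum_distrib_left)
  also have "\<dots> \<le> (\<Sum>j<q. (sv U (Suc j))\<^sup>2 * (cmod (c $ j))\<^sup>2)"
  proof (rule sum_mono)
    fix j assume "j \<in> {..<q}"
    thus "(sv U k)\<^sup>2 * (cmod (c $ j))\<^sup>2 \<le> (sv U (Suc j))\<^sup>2 * (cmod (c $ j))\<^sup>2"
      using c0[of j] by (cases "k \<le> j") (auto intro!: mult_right_mono power_mono sv_antimono)
  qed
  also have "\<dots> = nsq (U *\<^sub>v y)" unfolding yc using nsq_singular_basis[OF U P(1,4) c] by simp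
  finally show ?thesis by (simp add: y_def)
qed

text \<open>Let the unit vector \<open>v\<close> realize the norm of \<open>X\<close>. The Penrose
  equations put \<open>y = X v\<close> into the range of \<open>mat_adjoint U\<close>, where
  \<open>U\<close> stretches by at least \<open>sv U k\<close>, while \<open>U y = U X v\<close> is
  an orthogonal projection of \<open>v\<close> and so has length at most 1.\<close>

lemma spectral_norm_pinv:
  assumes U: "U \<in> carrier_mat p q" and X: "is_pinv U X" and 0: "sv U (Suc k) = 0"
  shows "spectral_norm X * sv U k \<le> 1"
proof (cases "p = 0")
  case True
  hence "spectral_norm X = 0" using is_pinvD(2)[OF X] U unfolding spectral_norm_def by (intro sv_beyond) simp
  thus ?thesis by simp
next
  case False
  note x = is_pinvD[OF X]
  have Xc: "X \<in> carrier_mat q p" using x(1,2) U by auto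
  have p1: "1 \<le> p" using False by simp
  obtain M where M: "M \<in> carrier_mat p 1" "\<And>c. c \<in> carrier_vec 1 \<Longrightarrow> nsq (M *\<^sub>v c) = nsq c"
    "\<And>c. c \<in> carrier_vec 1 \<Longrightarrow> (sv X 1)\<^sup>2 * nsq c \<le> nsq (X *\<^sub>v (M *\<^sub>v c))"
    using sv_top_subspace[OF Xc p1] by blast
  define c :: "complex vec" where "c = unit_vec 1 0"
  have c: "c \<in> carrier_vec 1" "nsq c = 1" by (auto simp: c_def nsq_def)
  define v where "v = M *\<^sub>v c"
  have v: "v \<in> carrier_vec p" "nsq v = 1" using M(1,2) c by (auto simp: v_def)
  define y where "y = X *\<^sub>v v"
  have y: "(sv X 1)\<^sup>2 \<le> nsq y" using M(3)[OF c(1)] c(2) by (simp add: y_def v_def)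
  define z where "z = mat_adjoint X *\<^sub>v y"
  have yc: "y \<in> carrier_vec q" using Xc v by (auto simp: y_def)
  have z: "z \<in> carrier_vec p" using mult_mat_vec_carrier[OF mat_adjoint_carrier[OF Xc] yc] by (simp add: z_def)
  have "mat_adjoint U *\<^sub>v z = mat_adjoint (X * U) *\<^sub>v y"
    using U Xc yc by (simp add: z_def mat_adjoint_times mat_vec_assoc)
  also have "\<dots> = (X * U * X) *\<^sub>v v" unfolding x(6) using U Xc v by (simp add: y_def mat_vec_assoc)
  also have "\<dots> = y" by (simp add: x(4) y_def)
  finally have yz: "mat_adjoint U *\<^sub>v z = y" .
  have "(sv U k)\<^sup>2 * nsq y \<le> nsq (U *\<^sub>v y)" using nsq_ge_sv_on_row_space[OF U z 0] by (simp add: yz)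
  also have "U *\<^sub>v y = (U * X) *\<^sub>v v" using U Xc v by (simp add: y_def mat_vec_assoc)
  also have "nsq \<dots> \<le> nsq v"
  proof (rule nsq_projection_le[OF _ _ x(5) v(1)])
    show "U * X \<in> carrier_mat p p" by (rule mult_carrier_mat[OF U Xc])
    show "U * X * (U * X) = U * X" 
    proof -
      have "U * X * (U * X) = (U * X * U) * X" using U Xc by (simp add: mat_mult_assoc)
      thus ?thesis by (simp only: x(3))
    qed
  qed
  finally have "(sv U k)\<^sup>2 * nsq y \<le> 1" using v(2) by simp
  moreover have "(sv U k)\<^sup>2 * (sv X 1)\<^sup>2 \<le> (sv U k)\<^sup>2 * nsq y" using y by (intro mult_left_mono) auto
  ultimately have "(sv U k * sv X 1)\<^sup>2 \<le> 1\<^sup>2" by (simp add: power_mult_distrib)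
  hence "sv U k * sv X 1 \<le> 1" by (rule power2_le_imp_le) simp
  thus ?thesis by (simp add: spectral_norm_def mult.commute)
qed

section \<open>Matrices over the scalar field and invariant norms\<close>

lemma mats_iff:
  "B \<in> mats K m n \<longleftrightarrow> B \<in> carrier_mat m n \<and> (\<forall>i<m. \<forall>j<n. B $$ (i, j) \<in> K)"
  by (auto simp: mats_def elements_mat_def UN_subset_iff image_subset_iff)

lemma mats_carrier: "B \<in> mats K m n \<Longrightarrow> B \<in> carrier_mat m n"
  by (simp add: mats_def)

section \<open>Singular values of rectangular diagonal matrices\<close>

text \<open>\<open>sv_diag\<close> with a free diagonal, as needed for truncated, shifted and
  sign-changed singular values.\<close>

definition rect_diag :: "nat \<Rightarrow> nat \<Rightarrow> (nat \<Rightarrow> real) \<Rightarrow> complex mat" where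
  "rect_diag p q d = mat p q (\<lambda>(i, j). if i = j then complex_of_real (d i) else 0)"

lemma rect_diag_carrier [simp]: "rect_diag p q d \<in> carrier_mat p q"
  by (simp add: rect_diag_def)

lemma dim_rect_diag [simp]: "dim_row (rect_diag p q d) = p" "dim_col (rect_diag p q d) = q"
  by (simp_all add: rect_diag_def)

lemma rect_diag_index [simp]:
  "i < p \<Longrightarrow> j < q \<Longrightarrow> rect_diag p q d $$ (i, j) = (if i = j then complex_of_real (d i) else 0)"
  by (simp add: rect_diag_def)

lemma sv_diag_rect_diag: "sv_diag p q B = rect_diag p q (\<lambda>i. sv B (Suc i))"
  by (simp add: sv_diag_def rect_diag_def)

lemma rect_diag_gram:
  "mat_adjoint (rect_diag p q d) * rect_diag p q d =
    mat_diag q (\<lambda>j. complex_of_real (if j < p then (d j)\<^sup>2 else 0))"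
proof (rule eq_matI)
  fix i j assume "i < dim_row (mat_diag q (\<lambda>j. complex_of_real (if j < p then (d j)\<^sup>2 else 0)))"
    "j < dim_col (mat_diag q (\<lambda>j. complex_of_real (if j < p then (d j)\<^sup>2 else 0)))"
  hence ij: "i < q" "j < q" by (auto simp: mat_diag_def)
  have "(mat_adjoint (rect_diag p q d) * rect_diag p q d) $$ (i, j) =
      (\<Sum>a<p. (if a = i then complex_of_real (d a) else 0) * (if a = j then complex_of_real (d a) else 0))"
    using ij by (auto simp: scalar_prod_def atLeast0LessThan intro!: sum.cong)
  also have "\<dots> = (\<Sum>a<p. if a = i then (if i = j then (complex_of_real (d i))\<^sup>2 else 0) else 0)"
    by (intro sum.cong) (auto simp: power2_eq_square)
  also have "\<dots> = mat_diag q (\<lambda>j. complex_of_real (if j < p then (d j)\<^sup>2 else 0)) $$ (i, j)"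
    using ij by (simp add: mat_diag_def)
  finally show "(mat_adjoint (rect_diag p q d) * rect_diag p q d) $$ (i, j) =
      mat_diag q (\<lambda>j. complex_of_real (if j < p then (d j)\<^sup>2 else 0)) $$ (i, j)" .
qed (auto simp: mat_diag_def)

lemma sv_list_diag_gram:
  assumes "mat_adjoint F * F = mat_diag q (\<lambda>j. complex_of_real (d j))"
  shows "sv_list F = rev (sort (map (\<lambda>j. sqrt (d j)) [0..<q]))"
proof -
  let ?D = "mat_diag q (\<lambda>j. complex_of_real (d j))"
  have "char_poly ?D = (\<Prod>a\<leftarrow>diag_mat ?D. [:- a, 1:])"
    by (rule char_poly_upper_triangular[of _ q]) (auto simp: mat_diag_def upper_triangular_def)
  moreover have "diag_mat ?D = map (\<lambda>j. complex_of_real (d j)) [0..<q]"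
    by (auto simp: diag_mat_def mat_diag_def)
  ultimately have "proots (char_poly ?D) = mset (map (\<lambda>j. complex_of_real (d j)) [0..<q])"
    using proots_prod_linear by metis
  thus ?thesis
    unfolding sv_list_def assms by (simp add: multiset.map_comp o_def flip: mset_map)
qed

lemma sv_diag_gram_eq:
  assumes F: "mat_adjoint F * F = mat_diag q (\<lambda>j. complex_of_real ((s (Suc j))\<^sup>2))"
    and nonneg: "\<And>i. 0 \<le> s i" and anti: "\<And>a b. 1 \<le> a \<Longrightarrow> a \<le> b \<Longrightarrow> s b \<le> s a"
    and i: "1 \<le> i" "i \<le> q"
  shows "sv F i = s i"
proof -
  let ?xs = "map (\<lambda>j. s (Suc j)) [0..<q]"
  have "sorted (rev ?xs)"
    by (auto simp: sorted_iff_nth_mono_less rev_nth intro!: anti)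
  moreover have "sort ?xs = sort (rev ?xs)" by (metis mset_rev sorted_list_of_multiset_mset)
  ultimately have "sort ?xs = rev ?xs" by (simp only: sorted_sort_id)
  moreover have "sv_list F = rev (sort ?xs)"
    unfolding sv_list_diag_gram[OF F] using nonneg by simp
  ultimately have "sv_list F = ?xs" by simp
  thus ?thesis using i by (cases i) (auto simp: sv_def)
qed

text \<open>\<open>sv_list\<close> has one entry per column. The entries past the number of rows
  vanish because \<open>F\<close> factors through \<open>dim_row F\<close> dimensions.\<close>

lemma sv_beyond_rows:
  assumes "dim_row F < i"
  shows "sv F i = 0"
proof -
  have "sv (1\<^sub>m (dim_row F) * F) i = 0"
    by (rule sv_of_low_rank[OF _ _ assms, of _ "dim_row F" _ "dim_col F"]) auto
  thus ?thesis by simp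
qed

lemma sv_sv_diag:
  assumes F: "F \<in> carrier_mat p q" and i: "1 \<le> i"
  shows "sv (sv_diag p q F) i = sv F i"
proof (cases "i \<le> q")
  case True
  have "mat_adjoint (sv_diag p q F) * sv_diag p q F = mat_diag q (\<lambda>j. complex_of_real ((sv F (Suc j))\<^sup>2))"
    unfolding sv_diag_rect_diag rect_diag_gram
    by (intro arg_cong[where f = "mat_diag q"] ext) (use F sv_beyond_rows[of F] in auto)
  from sv_diag_gram_eq[OF this sv_nonneg sv_antimono i True] show ?thesis .
next
  case False
  thus ?thesis using F sv_beyond[of F i] sv_beyond[of "sv_diag p q F" i] by (simp add: sv_diag_def)
qed

section \<open>Submatrices and truncated factors\<close>

lemma pick_lt: "i < card {a. a < n \<and> a \<in> I} \<Longrightarrow> pick I i < n"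
  using pick_le by blast

lemma pick_lessThan: "j < k \<Longrightarrow> pick {..<k} j = j"
proof -
  assume j: "j < k"
  have "j = pick {..<k} (card {a \<in> {..<k}. a < j})" by (rule pick_card_in_set[symmetric]) (use j in simp)
  moreover have "{a \<in> {..<k}. a < j} = {..<j}" using j by auto
  ultimately show ?thesis by simp
qed

lemma submatrix_mult:
  fixes A B :: "complex mat"
  assumes "dim_col A = dim_row B"
  shows "submatrix (A * B) I J = submatrix A I UNIV * submatrix B UNIV J"
proof (rule eq_matI)
  fix i j assume "i < dim_row (submatrix A I UNIV * submatrix B UNIV J)"
    "j < dim_col (submatrix A I UNIV * submatrix B UNIV J)"
  hence ij: "i < card {a. a < dim_row A \<and> a \<in> I}" "j < card {a. a < dim_col B \<and> a \<in> J}"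
    by (auto simp: dim_submatrix)
  have p: "pick I i < dim_row A" "pick J j < dim_col B" using pick_lt ij by auto
  have "submatrix (A * B) I J $$ (i, j) = (\<Sum>a<dim_row B. A $$ (pick I i, a) * B $$ (a, pick J j))"
    using ij p assms by (simp add: submatrix_index scalar_prod_def atLeast0LessThan)
  also have "\<dots> = (submatrix A I UNIV * submatrix B UNIV J) $$ (i, j)"
    using ij assms by (simp add: dim_submatrix scalar_prod_def atLeast0LessThan submatrix_index pick_UNIV)
  finally show "submatrix (A * B) I J $$ (i, j) = (submatrix A I UNIV * submatrix B UNIV J) $$ (i, j)" .
qed (auto simp: dim_submatrix)

lemma submatrix_UNIV [simp]: "submatrix A UNIV UNIV = A"
  by (rule eq_matI) (auto simp: dim_submatrix submatrix_index pick_UNIV)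

lemma submatrix_adjoint:
  "submatrix (mat_adjoint A) I J = mat_adjoint (submatrix A J I :: complex mat)"
  by (rule eq_matI) (auto simp: dim_submatrix submatrix_index pick_lt)

lemma submatrix_add:
  fixes A B :: "complex mat"
  assumes "A \<in> carrier_mat m n" "B \<in> carrier_mat m n"
  shows "submatrix (A + B) I J = submatrix A I J + submatrix B I J"
  by (rule eq_matI) (use assms in \<open>auto simp: dim_submatrix submatrix_index pick_lt\<close>)

lemma submatrix_mats:
  "A \<in> mats K m n \<Longrightarrow> submatrix A I J \<in> mats K (card {i. i < m \<and> i \<in> I}) (card {j. j < n \<and> j \<in> J})"
  by (auto simp: mats_iff dim_submatrix submatrix_index pick_lt intro!: carrier_matI)

lemma submatrix_initial_cols:
  assumes "A \<in> carrier_mat m n" "k \<le> n"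
  shows "submatrix A UNIV {..<k} = mat m k (\<lambda>(i, j). A $$ (i, j))"
proof -
  have "{j. j < n \<and> j \<in> {..<k}} = {..<k}" using assms(2) by auto
  thus ?thesis
    using assms by (intro eq_matI) (auto simp: dim_submatrix submatrix_index pick_UNIV pick_lessThan)
qed

lemma initial_cols_isometry:
  assumes W: "W \<in> carrier_mat m m" "mat_adjoint W * W = 1\<^sub>m m" and "k \<le> m"
  defines "Wk \<equiv> mat m k (\<lambda>(i, j). W $$ (i, j))"
  shows "mat_adjoint Wk * Wk = (1\<^sub>m k :: complex mat)"
proof (rule eq_matI)
  fix i j assume "i < dim_row (1\<^sub>m k :: complex mat)" "j < dim_col (1\<^sub>m k :: complex mat)"
  hence ij: "i < k" "j < k" by auto
  have "(mat_adjoint Wk * Wk) $$ (i, j) = (mat_adjoint W * W) $$ (i, j)"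
    using ij W(1) \<open>k \<le> m\<close> by (simp add: Wk_def scalar_prod_def)
  thus "(mat_adjoint Wk * Wk) $$ (i, j) = (1\<^sub>m k :: complex mat) $$ (i, j)"
    using ij \<open>k \<le> m\<close> by (simp add: W(2))
qed (auto simp: Wk_def)

text \<open>Turns the thin product into one with the full factors and a diagonal cut off after
  \<open>k\<close>, the shape to which unitary invariance applies.\<close>

lemma truncated_product:
  assumes W: "W \<in> carrier_mat p p" and V: "V \<in> carrier_mat q q" and k: "k \<le> min p q"
  defines "Wk \<equiv> mat p k (\<lambda>(i, j). W $$ (i, j))" and "Vk \<equiv> mat q k (\<lambda>(i, j). V $$ (i, j))"
  shows "Wk * rect_diag k k s * mat_adjoint Vk =
    W * rect_diag p q (\<lambda>i. if i < k then s i else 0) * mat_adjoint V"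
proof -
  have *: "(W' * rect_diag a b s') $$ (i, j) = (if j < a then W' $$ (i, j) * of_real (s' j) else 0)"
    if "W' \<in> carrier_mat p a" "i < p" "j < b" for W' a b s' i j
  proof -
    have "(W' * rect_diag a b s') $$ (i, j) = (\<Sum>l<a. W' $$ (i, l) * (if l = j then of_real (s' l) else 0))"
      using that by (simp add: scalar_prod_def atLeast0LessThan)
    also have "\<dots> = (\<Sum>l<a. if l = j then W' $$ (i, j) * of_real (s' j) else 0)"
      by (intro sum.cong) auto
    finally show ?thesis by simp
  qed
  show ?thesis
  proof (rule eq_matI)
    fix a b assume "a < dim_row (W * rect_diag p q (\<lambda>i. if i < k then s i else 0) * mat_adjoint V)"
      "b < dim_col (W * rect_diag p q (\<lambda>i. if i < k then s i else 0) * mat_adjoint V)"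
    hence ab: "a < p" "b < q" using W V by auto
    have "(Wk * rect_diag k k s * mat_adjoint Vk) $$ (a, b) =
        (\<Sum>j<k. (Wk * rect_diag k k s) $$ (a, j) * cnj (V $$ (b, j)))"
      using ab by (simp add: scalar_prod_def atLeast0LessThan Wk_def Vk_def)
    also have "\<dots> = (\<Sum>j<k. W $$ (a, j) * of_real (s j) * cnj (V $$ (b, j)))"
      using ab *[of Wk k a _ k s] by (intro sum.cong) (auto simp: Wk_def)
    also have "\<dots> = (\<Sum>j<q. (W * rect_diag p q (\<lambda>i. if i < k then s i else 0)) $$ (a, j) * cnj (V $$ (b, j)))"
      using ab k *[OF W ab(1), of _ q "\<lambda>i. if i < k then s i else 0"]
      by (intro sum.mono_neutral_cong_left) auto
    also have "\<dots> = (W * rect_diag p q (\<lambda>i. if i < k then s i else 0) * mat_adjoint V) $$ (a, b)"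
      using ab W V by (simp add: scalar_prod_def atLeast0LessThan)
    finally show "(Wk * rect_diag k k s * mat_adjoint Vk) $$ (a, b) = \<dots>" .
  qed (use W V in \<open>auto simp: Wk_def Vk_def\<close>)
qed

section \<open>Closure properties of the scalar field\<close>

locale scalar_field =
  fixes K :: "complex set"
  assumes K: "K = \<real> \<or> K = UNIV"
begin

lemma K_closed:
  "0 \<in> K" "1 \<in> K" "a \<in> K \<Longrightarrow> b \<in> K \<Longrightarrow> a + b \<in> K" "a \<in> K \<Longrightarrow> b \<in> K \<Longrightarrow> a - b \<in> K"
  "a \<in> K \<Longrightarrow> b \<in> K \<Longrightarrow> a * b \<in> K" "a \<in> K \<Longrightarrow> cnj a \<in> K" "complex_of_real r \<in> K"
  using K by (auto simp: Reals_cnj_iff)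

lemma K_sum: "(\<And>i. i \<in> A \<Longrightarrow> f i \<in> K) \<Longrightarrow> sum f A \<in> K"
  by (induction A rule: infinite_finite_induct) (auto intro: K_closed)

lemma mats_add: "A \<in> mats K m n \<Longrightarrow> B \<in> mats K m n \<Longrightarrow> A + B \<in> mats K m n"
  by (auto simp: mats_iff K_closed)

lemma mats_minus: "A \<in> mats K m n \<Longrightarrow> B \<in> mats K m n \<Longrightarrow> A - B \<in> mats K m n"
  by (auto simp: mats_iff K_closed)

lemma mats_mult: "A \<in> mats K m n \<Longrightarrow> B \<in> mats K n p \<Longrightarrow> A * B \<in> mats K m p"
  by (auto simp: mats_iff scalar_prod_def intro!: K_closed K_sum)

lemma mats_adjoint: "A \<in> mats K m n \<Longrightarrow> mat_adjoint A \<in> mats K n m"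
  by (auto simp: mats_iff intro!: K_closed)

lemma mats_one: "1\<^sub>m n \<in> mats K n n"
  by (auto simp: mats_iff K_closed)

lemma mats_rect_diag: "rect_diag p q d \<in> mats K p q"
  by (auto simp: mats_iff K_closed)

lemma mats_smult: "c \<in> K \<Longrightarrow> A \<in> mats K m n \<Longrightarrow> c \<cdot>\<^sub>m A \<in> mats K m n"
  by (auto simp: mats_iff K_closed)

text \<open>In the real case, entrywise conjugation fixes \<open>B\<close> and preserves the Penrose
  equations, so by uniqueness it fixes \<open>X\<close> as well.\<close>

lemma is_pinv_mats:
  assumes B: "B \<in> mats K m n" and X: "is_pinv B X"
  shows "X \<in> mats K n m"
proof (cases "K = UNIV")
  case True
  thus ?thesis using is_pinvD(1,2)[OF X] B by (auto simp: mats_iff)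
next
  case False
  hence K: "K = \<real>" using K by simp
  let ?c = "map_mat cnj"
  have cmult: "?c (A * C) = ?c A * ?c C" if "dim_col A = dim_row C" for A C
    using that by (intro eq_matI) (auto simp: scalar_prod_def)
  have cadj: "?c (mat_adjoint A) = mat_adjoint (?c A)" for A
    by (intro eq_matI) auto
  have cB: "?c B = B"
    using B by (intro eq_matI) (auto simp: mats_iff K Reals_cnj_iff)
  note x = is_pinvD[OF X]
  have "?c B * ?c X * ?c B = ?c B"
    using arg_cong[OF x(3), of ?c] x(1,2) by (simp only: cmult index_mult_mat)
  moreover have "?c X * ?c B * ?c X = ?c X"
    using arg_cong[OF x(4), of ?c] x(1,2) by (simp only: cmult index_mult_mat)
  moreover have "mat_adjoint (?c B * ?c X) = ?c B * ?c X"
    using arg_cong[OF x(5), of ?c] x(1,2) by (simp only: cmult cadj)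
  moreover have "mat_adjoint (?c X * ?c B) = ?c X * ?c B"
    using arg_cong[OF x(6), of ?c] x(1,2) by (simp only: cmult cadj)
  moreover have "?c X \<in> carrier_mat (dim_col (?c B)) (dim_row (?c B))"
    by (rule carrier_matI) (simp_all add: x(1,2))
  ultimately have "is_pinv (?c B) (?c X)" unfolding is_pinv_def by blast
  hence "is_pinv B (?c X)" by (simp only: cB)
  hence cX: "?c X = X" using X by (rule is_pinv_unique)
  have "cnj (X $$ (i, j)) = X $$ (i, j)" if "i < n" "j < m" for i j
    using arg_cong[OF cX, of "\<lambda>M. M $$ (i, j)"] that x(1,2) mats_carrier[OF B] by simp
  thus ?thesis using x(1,2) B by (auto simp: mats_iff K Reals_cnj_iff intro!: carrier_matI)
qed

end

section \<open>Norms determined by singular values\<close>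

locale invariant_norm = scalar_field +
  fixes N :: "complex mat \<Rightarrow> real"
  assumes norm_family: "matrix_norm_family K N" and normalized: "normalized_norm K N"
    and unif: "uniformly_generated K N" and unit_inv: "unitarily_invariant K N"
    and submult: "submultiplicative_norm K N"
begin

lemma N_nonneg: "1 \<le> m \<Longrightarrow> 1 \<le> n \<Longrightarrow> B \<in> mats K m n \<Longrightarrow> 0 \<le> N B"
  using norm_family by (auto simp: matrix_norm_family_def)

lemma N_smult: "1 \<le> m \<Longrightarrow> 1 \<le> n \<Longrightarrow> B \<in> mats K m n \<Longrightarrow> c \<in> K \<Longrightarrow> N (c \<cdot>\<^sub>m B) = cmod c * N B"
  using norm_family by (auto simp: matrix_norm_family_def)

lemma N_add: "1 \<le> m \<Longrightarrow> 1 \<le> n \<Longrightarrow> B \<in> mats K m n \<Longrightarrow> D \<in> mats K m n \<Longrightarrow> N (B + D) \<le> N B + N D"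
  using norm_family by (auto simp: matrix_norm_family_def)

lemma N_mult:
  "1 \<le> m \<Longrightarrow> 1 \<le> n \<Longrightarrow> 1 \<le> p \<Longrightarrow> B \<in> mats K m n \<Longrightarrow> D \<in> mats K n p \<Longrightarrow> N (B * D) \<le> N B * N D"
  using submult by (auto simp: submultiplicative_norm_def)

lemma N_minus_commute:
  assumes "1 \<le> m" "1 \<le> n" "B \<in> mats K m n" "D \<in> mats K m n"
  shows "N (B - D) = N (D - B)"
proof -
  have "B - D = (-1) \<cdot>\<^sub>m (D - B)" using assms by (intro eq_matI) (auto simp: mats_iff)
  moreover have "-1 \<in> K" using K by auto
  ultimately show ?thesis using N_smult[OF assms(1,2) mats_minus[OF assms(4,3)]] by simp
qed

lemma N_diff:
  assumes "1 \<le> m" "1 \<le> n" "B \<in> mats K m n" "D \<in> mats K m n"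
  shows "N (B - D) \<le> N B + N D"
proof -
  have "B - D = B + (-1) \<cdot>\<^sub>m D" using assms by (intro eq_matI) (auto simp: mats_iff)
  moreover have 1: "-1 \<in> K" using K by auto
  ultimately show ?thesis
    using N_add[OF assms(1-3) mats_smult[OF 1 assms(4)]] N_smult[OF assms(1,2,4) 1] by simp
qed

text \<open>The two sizes may differ; this is how uniform generation is exploited, for adjoints as
  well as for factors with orthonormal columns.\<close>

lemma N_sv_cong:
  assumes "1 \<le> m" "1 \<le> n" "B \<in> mats K m n" "1 \<le> m'" "1 \<le> n'" "D \<in> mats K m' n'"
    and "\<And>i. 1 \<le> i \<Longrightarrow> sv B i = sv D i"
  shows "N B = N D"
proof -
  obtain \<phi> where \<phi>: "\<forall>m\<ge>1. \<forall>n\<ge>1. \<forall>B\<in>mats K m n. N B = \<phi> (\<lambda>i. sv B (Suc i))"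
    using unif by (auto simp: uniformly_generated_def)
  have "(\<lambda>i. sv B (Suc i)) = (\<lambda>i. sv D (Suc i))" using assms(7) by auto
  thus ?thesis using \<phi> assms(1-6) by metis
qed

lemma N_adjoint:
  assumes "1 \<le> m" "1 \<le> n" "B \<in> mats K m n"
  shows "N (mat_adjoint B) = N B"
  by (rule N_sv_cong[OF assms(2,1) mats_adjoint[OF assms(3)] assms sv_adjoint])

text \<open>\<open>W * M\<close> and \<open>M\<close> have the same Gram matrix, hence the same
  singular values. As \<open>W\<close> need not be square, unitary invariance does not apply to
  it.\<close>

lemma N_isometry_mult:
  assumes "1 \<le> m" "1 \<le> k" "1 \<le> n" and W: "W \<in> mats K m k" "mat_adjoint W * W = 1\<^sub>m k"
    and M: "M \<in> mats K k n"
  shows "N (W * M) = N M"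
proof (rule N_sv_cong[OF assms(1,3) mats_mult[OF W(1) M] assms(2,3) M])
  have "mat_adjoint (W * M) * (W * M) = mat_adjoint M * ((mat_adjoint W * W) * M)"
    using W(1) M by (auto simp: mats_iff mat_adjoint_times mat_mult_assoc)
  also have "\<dots> = mat_adjoint M * M" using mats_carrier[OF M] by (simp add: W(2))
  finally show "sv (W * M) i = sv M i" for i using sv_cong_gram by metis
qed

text \<open>\<open>S = 2 P - 1\<close> is unitary, and \<open>P D\<close> is the mean of \<open>D\<close> and \<open>S D\<close>.\<close>

lemma N_projection_mult:
  assumes "1 \<le> m" "1 \<le> n" and P: "P \<in> mats K m m" "P * P = P" "mat_adjoint P = P"
    and D: "D \<in> mats K m n"
  shows "N (P * D) \<le> N D"
proof -
  define S where "S = P + P - 1\<^sub>m m"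
  note Pc = mats_carrier[OF P(1)] and Dc = mats_carrier[OF D]
  have S: "S \<in> mats K m m" unfolding S_def by (intro mats_minus mats_add P(1) mats_one)
  note Sc = mats_carrier[OF S]
  have adj: "mat_adjoint S = S"
  proof -
    have *: "cnj (P $$ (j, i)) = P $$ (i, j)" if "i < m" "j < m" for i j
      using arg_cong[OF P(3), of "\<lambda>M. M $$ (i, j)"] that Pc by simp
    show ?thesis unfolding S_def using Pc * by (intro eq_matI) auto
  qed
  have SP: "S * P = P"
  proof -
    have "S * P = P * P + P * P - 1\<^sub>m m * P"
      unfolding S_def using Pc by (simp add: minus_mult_distrib_mat[of _ m m] add_mult_distrib_mat[of _ m m])
    also have "\<dots> = P" unfolding P(2) using Pc by (intro eq_matI) auto
    finally show ?thesis .
  qed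
  have "S * S = S * (P + P) - S * 1\<^sub>m m"
    by (subst (2) S_def) (use Pc Sc in \<open>simp add: mult_minus_distrib_mat[of _ m m _ m]\<close>)
  also have "S * (P + P) = S * P + S * P" using Pc Sc by (simp add: mult_add_distrib_mat[of _ m m _ m])
  also have "\<dots> - S * 1\<^sub>m m = P + P - S" using Sc by (simp add: SP)
  also have "\<dots> = 1\<^sub>m m" unfolding S_def using Pc by (intro eq_matI) auto
  finally have "is_unitary S" using adj Sc by (simp add: is_unitary_def)
  moreover have "is_unitary (1\<^sub>m n)" by (simp add: is_unitary_def)
  ultimately have "N (S * D * 1\<^sub>m n) = N D"
    using unit_inv assms(1,2) S D mats_one unfolding unitarily_invariant_def by blast
  hence NS: "N (S * D) = N D" using Sc Dc by simp
  have "2 \<cdot>\<^sub>m (P * D) = (S + 1\<^sub>m m) * D"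
  proof -
    have "S + 1\<^sub>m m = 2 \<cdot>\<^sub>m P" unfolding S_def using Pc by (intro eq_matI) auto
    thus ?thesis using Pc Dc by (simp add: mult_smult_assoc_mat[of _ m m])
  qed
  also have "\<dots> = S * D + D" using Sc Dc by (simp add: add_mult_distrib_mat[of _ m m])
  finally have "N (2 \<cdot>\<^sub>m (P * D)) \<le> N (S * D) + N D"
    using N_add[OF assms(1,2) mats_mult[OF S D] D] by simp
  moreover have "2 \<in> K" using K by auto
  ultimately show ?thesis using N_smult[OF assms(1,2) mats_mult[OF P(1) D], of 2] NS by simp
qed

lemma N_mult_projection:
  assumes "1 \<le> m" "1 \<le> n" and P: "P \<in> mats K n n" "P * P = P" "mat_adjoint P = P"
    and D: "D \<in> mats K m n"
  shows "N (D * P) \<le> N D"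
proof -
  have "N (D * P) = N (mat_adjoint (D * P))"
    using N_adjoint[OF assms(1,2) mats_mult[OF D P(1)]] by simp
  also have "mat_adjoint (D * P) = P * mat_adjoint D"
    using mats_carrier[OF D] mats_carrier[OF P(1)] by (simp add: mat_adjoint_times P(3))
  also have "N \<dots> \<le> N (mat_adjoint D)"
    by (rule N_projection_mult[OF assms(2,1) P mats_adjoint[OF D]])
  also have "\<dots> = N D" by (rule N_adjoint[OF assms(1,2) D])
  finally show ?thesis .
qed

text \<open>Obtained by comparing singular values, so that no SVD of \<open>B\<close> with factors
  over \<open>K\<close> has to be constructed.\<close>

lemma N_sv_diag:
  assumes "1 \<le> m" "1 \<le> n" "B \<in> mats K m n"
  shows "N (sv_diag m n B) = N B"
  by (rule N_sv_cong[OF assms(1,2) _ assms])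
    (auto simp: sv_diag_rect_diag mats_rect_diag sv_sv_diag[OF mats_carrier[OF assms(3)], unfolded sv_diag_rect_diag])

text \<open>The diagonal matrix of singular values sends the first unit vector to
  \<open>sv B 1\<close> times a unit vector. Normalization evaluates the norms of both vectors, and
  submultiplicativity compares them.\<close>

lemma spectral_norm_le_N:
  assumes "1 \<le> m" "1 \<le> n" "B \<in> mats K m n"
  shows "spectral_norm B \<le> N B"
proof -
  define x :: "complex mat" where "x = mat n 1 (\<lambda>(i, j). if i = 0 then 1 else 0)"
  define y :: "complex mat" where "y = mat m 1 (\<lambda>(i, j). if i = 0 then of_real (sv B 1) else 0)"
  have x: "x \<in> mats K n 1" and y: "y \<in> mats K m 1" by (auto simp: x_def y_def mats_iff K_closed)
  have S: "sv_diag m n B \<in> mats K m n" unfolding sv_diag_rect_diag by (rule mats_rect_diag)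
  have Sx: "sv_diag m n B * x = y"
  proof (rule eq_matI)
    fix i j assume "i < dim_row y" "j < dim_col y"
    hence ij: "i < m" "j = 0" by (auto simp: y_def)
    have "(sv_diag m n B * x) $$ (i, j) =
        (\<Sum>a<n. (if i = a then of_real (sv B (Suc i)) else 0) * (if a = 0 then 1 else 0))"
      using ij by (auto simp: sv_diag_rect_diag x_def scalar_prod_def atLeast0LessThan intro!: sum.cong)
    also have "\<dots> = (\<Sum>a<n. if a = 0 then (if i = 0 then of_real (sv B 1) else 0) else 0)"
      by (intro sum.cong) auto
    also have "\<dots> = y $$ (i, j)" using ij assms(2) by (simp add: y_def)
    finally show "(sv_diag m n B * x) $$ (i, j) = y $$ (i, j)" .
  qed (auto simp: sv_diag_def x_def y_def)
  have "N x = sqrt (\<Sum>i<n. (cmod (x $$ (i, 0)))\<^sup>2)"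
    using normalized assms(2) x unfolding normalized_norm_def by blast
  also have "(\<Sum>i<n. (cmod (x $$ (i, 0)))\<^sup>2) = (\<Sum>i<n. if i = 0 then 1 else 0)"
    by (intro sum.cong) (auto simp: x_def)
  finally have Nx: "N x = 1" using assms(2) by simp
  have "N y = sqrt (\<Sum>i<m. (cmod (y $$ (i, 0)))\<^sup>2)"
    using normalized assms(1) y unfolding normalized_norm_def by blast
  also have "(\<Sum>i<m. (cmod (y $$ (i, 0)))\<^sup>2) = (\<Sum>i<m. if i = 0 then (sv B 1)\<^sup>2 else 0)"
    by (intro sum.cong) (auto simp: y_def)
  finally have Ny: "N y = sv B 1" using assms(1) by simp
  have "N y \<le> N (sv_diag m n B) * N x"
    using N_mult[OF assms(1,2) _ S x] Sx by simp
  thus ?thesis by (simp add: Nx Ny N_sv_diag[OF assms] spectral_norm_def)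
qed

text \<open>The singular values of a rectangular diagonal matrix are the absolute values of its
  diagonal, filled up with zeros to \<open>q\<close> entries and sorted. Signs and order of the
  diagonal therefore do not matter.\<close>

lemma N_rect_diag_cong_mset:
  assumes "1 \<le> p" "1 \<le> q"
    and "mset (map (\<lambda>j. if j < p then \<bar>d j\<bar> else 0) [0..<q]) = mset (map (\<lambda>j. if j < p then \<bar>d' j\<bar> else 0) [0..<q])"
  shows "N (rect_diag p q d) = N (rect_diag p q d')"
proof -
  have "sv_list (rect_diag p q d) = rev (sort (map (\<lambda>j. if j < p then \<bar>d j\<bar> else 0) [0..<q]))" for d
  proof -
    have "map (\<lambda>j. sqrt (if j < p then (d j)\<^sup>2 else 0)) [0..<q] = map (\<lambda>j. if j < p then \<bar>d j\<bar> else 0) [0..<q]"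
      by (rule map_cong) auto
    thus ?thesis by (simp only: sv_list_diag_gram[OF rect_diag_gram])
  qed
  moreover have "sort (map (\<lambda>j. if j < p then \<bar>d j\<bar> else 0) [0..<q]) =
      sort (map (\<lambda>j. if j < p then \<bar>d' j\<bar> else 0) [0..<q])"
    using arg_cong[OF assms(3), of sorted_list_of_multiset] by (simp only: sorted_list_of_multiset_mset)
  ultimately have "sv (rect_diag p q d) i = sv (rect_diag p q d') i" for i
    by (simp add: sv_def)
  thus ?thesis by (intro N_sv_cong[OF assms(1,2) mats_rect_diag assms(1,2) mats_rect_diag])
qed

text \<open>
  The new matrix is a convex combination of the old one and of the old one with the \<open>i\<close>-th sign flipped,
  which has the same singular values. If \<open>d i = 0\<close>, then also \<open>t = 0\<close>, and the quotient \<open>t / d i = 0\<close> still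
  gives correct weights.
\<close>

lemma N_rect_diag_shrink:
  assumes "1 \<le> p" "1 \<le> q" "\<bar>t\<bar> \<le> \<bar>d i\<bar>"
  shows "N (rect_diag p q (d(i := t))) \<le> N (rect_diag p q d)"
proof -
  define a where "a = (1 + t / d i) / 2"
  define b where "b = (1 - t / d i) / 2"
  have "\<bar>t / d i\<bar> \<le> 1" using assms(3) by (cases "d i = 0") (auto simp: divide_le_eq)
  hence "- 1 \<le> t / d i" "t / d i \<le> 1" by linarith+
  hence ab: "0 \<le> a" "0 \<le> b" "a + b = 1" by (auto simp: a_def b_def field_simps)
  have t: "t = a * d i - b * d i" using assms(3) by (cases "d i = 0") (auto simp: a_def b_def field_simps)
  have dl: "d l = a * d l + b * d l" for l using ab(3) by (metis distrib_right mult_1)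
  define D where "D = rect_diag p q d"
  define D' where "D' = rect_diag p q (d(i := - d i))"
  have DK: "D \<in> mats K p q" "D' \<in> mats K p q" by (auto simp: D_def D'_def mats_rect_diag)
  have ab': "complex_of_real a \<in> K" "complex_of_real b \<in> K" by (rule K_closed)+
  have eq: "rect_diag p q (d(i := t)) = complex_of_real a \<cdot>\<^sub>m D + complex_of_real b \<cdot>\<^sub>m D'"
  proof (rule eq_matI)
    fix r s assume "r < dim_row (complex_of_real a \<cdot>\<^sub>m D + complex_of_real b \<cdot>\<^sub>m D')"
      "s < dim_col (complex_of_real a \<cdot>\<^sub>m D + complex_of_real b \<cdot>\<^sub>m D')"
    hence rs: "r < p" "s < q" by (auto simp: D'_def)
    have "complex_of_real (d s) = of_real a * of_real (d s) + of_real b * of_real (d s)"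
      by (subst dl) simp
    moreover have "complex_of_real t = of_real a * of_real (d i) - of_real b * of_real (d i)"
      by (subst t) simp
    ultimately show "rect_diag p q (d(i := t)) $$ (r, s) = (complex_of_real a \<cdot>\<^sub>m D + complex_of_real b \<cdot>\<^sub>m D') $$ (r, s)"
      using rs by (auto simp: D_def D'_def)
  qed (auto simp: D'_def)
  have D'D: "N D' = N D"
    unfolding D_def D'_def
    by (rule N_rect_diag_cong_mset[OF assms(1,2)]) (intro arg_cong[where f = mset] map_cong, auto)
  have "N (rect_diag p q (d(i := t))) \<le> N (complex_of_real a \<cdot>\<^sub>m D) + N (complex_of_real b \<cdot>\<^sub>m D')"
    unfolding eq by (intro N_add[OF assms(1,2)] mats_smult DK ab')
  also have "\<dots> = a * N D + b * N D"
    using N_smult[OF assms(1,2) DK(1) ab'(1)] N_smult[OF assms(1,2) DK(2) ab'(2)] ab D'D by simp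
  also have "\<dots> = N D" using ab(3) by (metis distrib_right mult_1)
  finally show ?thesis by (simp add: D_def)
qed

text \<open>The entries are shrunk one at a time by \<open>N_rect_diag_shrink\<close>.\<close>

lemma N_rect_diag_mono:
  assumes "1 \<le> p" "1 \<le> q" "\<And>i. \<bar>d' i\<bar> \<le> \<bar>d i\<bar>"
  shows "N (rect_diag p q d') \<le> N (rect_diag p q d)"
proof -
  have "N (rect_diag p q (\<lambda>i. if i < r then d' i else d i)) \<le> N (rect_diag p q d)" for r
  proof (induction r)
    case (Suc r)
    have "(\<lambda>i. if i < Suc r then d' i else d i) = (\<lambda>i. if i < r then d' i else d i)(r := d' r)"
      by (auto simp: less_Suc_eq)
    thus ?case
      using N_rect_diag_shrink[OF assms(1,2), of "d' r" "\<lambda>i. if i < r then d' i else d i" r]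
        assms(3) Suc by simp
  qed simp
  note this[of p]
  also have "rect_diag p q (\<lambda>i. if i < p then d' i else d i) = rect_diag p q d'"
    by (rule eq_matI) auto
  finally show ?thesis .
qed

text \<open>By unitary invariance the left side is the norm of the diagonal of singular values after
  the \<open>k\<close>-th. Shifted to the front, these are dominated entry by entry by the singular
  values of \<open>B - L * G\<close>, and \<open>N_rect_diag_mono\<close> concludes.\<close>

lemma mirsky_low_rank:
  assumes pq: "1 \<le> p" "1 \<le> q" and B: "B \<in> mats K p q" and svd: "is_svd K B W V" and k: "k \<le> min p q"
    and LG: "L \<in> carrier_mat p k" "G \<in> carrier_mat k q" and F: "B - L * G \<in> mats K p q"
  shows "N (B - W * rect_diag p q (\<lambda>i. if i < k then sv B (Suc i) else 0) * mat_adjoint V) \<le> N (B - L * G)"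
proof -
  let ?s = "\<lambda>i. sv B (Suc i)"
  let ?head = "rect_diag p q (\<lambda>i. if i < k then ?s i else 0)"
  let ?tail = "rect_diag p q (\<lambda>i. if i < k then 0 else ?s i)"
  have Bc: "B \<in> carrier_mat p q" using B by (rule mats_carrier)
  have W: "W \<in> mats K p p" "is_unitary W" and V: "V \<in> mats K q q" "is_unitary V"
    and Beq: "B = W * sv_diag p q B * mat_adjoint V"
    using svd Bc by (auto simp: is_svd_def)
  note Wc = mats_carrier[OF W(1)] and Vc = mats_carrier[OF V(1)]
  have Vadj: "is_unitary (mat_adjoint V)" using V(2) Vc by (auto simp: is_unitary_def)
  have split: "sv_diag p q B - ?head = ?tail"
    by (rule eq_matI) (auto simp: sv_diag_rect_diag)
  have "B - W * ?head * mat_adjoint V = W * sv_diag p q B * mat_adjoint V - W * ?head * mat_adjoint V"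
    using Beq by simp
  also have "\<dots> = (W * sv_diag p q B - W * ?head) * mat_adjoint V"
    by (rule minus_mult_distrib_mat[of _ p q _ _ q, symmetric])
      (use Wc Vc in \<open>auto simp: sv_diag_rect_diag intro!: mult_carrier_mat[of _ p p]\<close>)
  also have "W * sv_diag p q B - W * ?head = W * ?tail"
    unfolding split[symmetric] by (rule mult_minus_distrib_mat[of _ p p _ q, symmetric])
      (use Wc in \<open>auto simp: sv_diag_rect_diag\<close>)
  finally have "N (B - W * ?head * mat_adjoint V) = N (W * ?tail * mat_adjoint V)" by simp
  also have "\<dots> = N ?tail"
    using unit_inv pq W mats_adjoint[OF V(1)] Vadj mats_rect_diag unfolding unitarily_invariant_def by blast
  \<comment> \<open>Moves the \<open>k\<close> leading zeros to the end, so that each position can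
    be compared with a singular value of \<open>B - L * G\<close>. Nothing is lost, because
    \<open>?s\<close> vanishes from \<open>p\<close> and from \<open>q\<close> on.\<close>
  also have "\<dots> = N (rect_diag p q (\<lambda>i. ?s (k + i)))"
  proof (rule N_rect_diag_cong_mset[OF pq])
    have s0: "?s j = 0" if "p \<le> j" for j using sv_beyond_rows[of B "Suc j"] Bc that by simp
    have s0': "?s j = 0" if "q \<le> j" for j using sv_beyond[of B "Suc j"] Bc that by simp
    have kq: "k \<le> q" "k \<le> p" using k by auto
    have upt: "[0..<q] = [0..<k] @ [k..<q]" using upt_add_eq_append[of 0 k "q - k"] kq by simp
    have zeros: "map (\<lambda>j. if j < p then \<bar>if j < k then 0 else ?s j\<bar> else 0) [0..<k] = replicate k 0"
      by (rule nth_equalityI) auto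
    have rest: "map (\<lambda>j. if j < p then \<bar>if j < k then 0 else ?s j\<bar> else 0) [k..<q] = map ?s [k..<q]"
      by (rule map_cong) (use s0 in auto)
    have 1: "map (\<lambda>j. if j < p then \<bar>if j < k then 0 else ?s j\<bar> else 0) [0..<q] =
        replicate k 0 @ map ?s [k..<q]"
      by (simp only: upt map_append zeros rest)
    have 2: "map (\<lambda>j. if j < p then \<bar>?s (k + j)\<bar> else 0) [0..<q] = map ?s [k..<q] @ replicate k 0"
      using s0 s0' kq by (auto simp: list_eq_iff_nth_eq nth_append)
    show "mset (map (\<lambda>j. if j < p then \<bar>if j < k then 0 else ?s j\<bar> else 0) [0..<q]) =
      mset (map (\<lambda>j. if j < p then \<bar>?s (k + j)\<bar> else 0) [0..<q])"
      unfolding 1 2 by simp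
  qed
  also have "\<dots> \<le> N (rect_diag p q (\<lambda>i. sv (B - L * G) (Suc i)))"
    by (rule N_rect_diag_mono[OF pq])
      (use sv_low_rank_perturbation[OF Bc LG, of "Suc _"] in simp)
  also have "\<dots> = N (B - L * G)" using N_sv_diag[OF pq F] by (simp add: sv_diag_rect_diag)
  finally show ?thesis .
qed

end

section \<open>The error bound\<close>

context invariant_norm
begin

text \<open>The bound must not involve \<open>N T\<close> or \<open>N U\<close>. So \<open>X\<close>
  is absorbed into the projections \<open>P\<close> and \<open>Q\<close> wherever it meets
  \<open>T\<close>, and is left over only between two of the small matrices \<open>D\<close>,
  \<open>EI\<close>, \<open>EJ\<close>.\<close>

lemma cur_error_bound:
  assumes dims: "1 \<le> m" "1 \<le> n" "1 \<le> p" "1 \<le> q"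
    and L: "L \<in> mats K m p" and U: "U \<in> mats K p q" and R: "R \<in> mats K q n"
    and EI: "EI \<in> mats K p n" and EJ: "EJ \<in> mats K m q"
    and T: "T \<in> mats K p q" and X: "is_pinv T X" and d: "N (T - U) \<le> d"
  shows "N (L * U * R - (L * U + EJ) * X * (U * R + EI)) \<le>
    N L * N R * (2 * d + d\<^sup>2 * N X) + N L * N EI * (1 + d * N X) + N R * N EJ * (1 + d * N X)
      + N EJ * N X * N EI"
proof -
  note x = is_pinvD[OF X]
  have Xm: "X \<in> mats K q p" by (rule is_pinv_mats[OF T X])
  note c = mats_carrier[OF L] mats_carrier[OF U] mats_carrier[OF R] mats_carrier[OF EI]
    mats_carrier[OF EJ] mats_carrier[OF T] mats_carrier[OF Xm]
  define D where "D = T - U"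
  have D: "D \<in> mats K p q" unfolding D_def by (rule mats_minus[OF T U])
  note Dc = mats_carrier[OF D]
  have UT: "U = T - D" unfolding D_def using c by (intro eq_matI) auto
  define P where "P = T * X"
  define Q where "Q = X * T"
  have P: "P \<in> mats K p p" "P * P = P" "mat_adjoint P = P"
  proof -
    show "P \<in> mats K p p" unfolding P_def by (rule mats_mult[OF T Xm])
    have "P * P = (T * X * T) * X" unfolding P_def using c by (simp add: mat_mult_assoc)
    thus "P * P = P" by (simp only: x(3) P_def)
    show "mat_adjoint P = P" unfolding P_def by (rule x(5))
  qed
  have Q: "Q \<in> mats K q q" "Q * Q = Q" "mat_adjoint Q = Q"
  proof -
    show "Q \<in> mats K q q" unfolding Q_def by (rule mats_mult[OF Xm T])
    have "Q * Q = (X * T * X) * T" unfolding Q_def using c by (simp add: mat_mult_assoc)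
    thus "Q * Q = Q" by (simp only: x(4) Q_def)
    show "mat_adjoint Q = Q" unfolding Q_def by (rule x(6))
  qed
  note PQc = mats_carrier[OF P(1)] mats_carrier[OF Q(1)]
  \<comment> \<open>The complementary projection, so that \<open>D - P * D\<close> costs only one
    \<open>N D\<close>.\<close>
  define P' where "P' = 1\<^sub>m p - P"
  have P': "P' \<in> mats K p p" "P' * P' = P'" "mat_adjoint P' = P'"
  proof -
    show "P' \<in> mats K p p" unfolding P'_def by (rule mats_minus[OF mats_one P(1)])
    have PP': "P * P' = 0\<^sub>m p p"
      unfolding P'_def using PQc by (simp add: mult_minus_distrib_mat[of _ p p _ p] P(2))
    have "P' * P' = 1\<^sub>m p * P' - P * P'"
      by (subst (1) P'_def) (rule minus_mult_distrib_mat, use PQc in \<open>auto simp: P'_def\<close>)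
    thus "P' * P' = P'" unfolding PP' using PQc by (simp add: P'_def) (intro eq_matI, auto)
    show "mat_adjoint P' = P'" unfolding P'_def using PQc by (simp add: mat_adjoint_minus[of _ p p] P(3))
  qed
  have UX: "U * X = P - D * X"
    unfolding UT P_def using c Dc by (simp add: minus_mult_distrib_mat[of _ p q _ _ p])
  have XU: "X * U = Q - X * D"
    unfolding UT Q_def using c Dc by (simp add: mult_minus_distrib_mat[of _ q p _ q])
  have DX: "D * X \<in> mats K p p" by (rule mats_mult[OF D Xm])
  have XD: "X * D \<in> mats K q q" by (rule mats_mult[OF Xm D])
  have PD: "P' * D \<in> mats K p q" by (rule mats_mult[OF P'(1) D])
  have DQ: "D * Q \<in> mats K p q" by (rule mats_mult[OF D Q(1)])
  have DXD: "D * X * D \<in> mats K p q" by (rule mats_mult[OF DX D])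
  \<comment> \<open>With \<open>U = T - D\<close> on both sides of \<open>X\<close>, the part
    \<open>T X T = T\<close> cancels. Two projected copies of \<open>D\<close> remain, which account
    for \<open>2 * d\<close>, and \<open>D X D\<close>, which accounts for
    \<open>d^2 * N X\<close>.\<close>
  have UXU: "U - U * X * U = (D * Q - P' * D) - D * X * D"
  proof -
    have "U * X * U = (P - D * X) * T - (P - D * X) * D"
      unfolding UX by (subst UT) (rule mult_minus_distrib_mat[OF mats_carrier[OF mats_minus[OF P(1) DX]] c(6) Dc])
    also have "(P - D * X) * T = P * T - D * X * T"
      using c PQc Dc mats_carrier[OF DX] by (simp add: minus_mult_distrib_mat[of _ p p _ _ q])
    also have "P * T = T" unfolding P_def by (rule x(3))
    also have "D * X * T = D * Q" unfolding Q_def using c Dc by (simp add: mat_mult_assoc)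
    also have "(P - D * X) * D = P * D - D * X * D"
      using PQc Dc mats_carrier[OF DX] by (simp add: minus_mult_distrib_mat[of _ p p _ _ q])
    finally have 1: "U * X * U = T - D * Q - (P * D - D * X * D)" .
    have 2: "P' * D = D - P * D"
      unfolding P'_def using PQc Dc by (simp add: minus_mult_distrib_mat[of _ p p _ _ q])
    have PDc: "P * D \<in> carrier_mat p q" by (rule mult_carrier_mat[OF PQc(1) Dc])
    have "T - D - (T - DQ - (PD - DXD)) = (DQ - (D - PD)) - DXD"
      if "DQ \<in> carrier_mat p q" "PD \<in> carrier_mat p q" "DXD \<in> carrier_mat p q" for DQ PD DXD
      using that c Dc by (intro eq_matI) auto
    from this[OF mats_carrier[OF DQ] PDc mats_carrier[OF DXD]] show ?thesis
      unfolding 1 2 by (simp only: UT[symmetric])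
  qed
  have n0: "0 \<le> N L" "0 \<le> N R" "0 \<le> N EI" "0 \<le> N EJ" "0 \<le> N X" "0 \<le> N D"
    using N_nonneg dims L R EI EJ Xm D by blast+
  have d': "N D \<le> d" using d by (simp add: D_def)
  have d0: "0 \<le> d" using d' n0 by linarith
  have NDX: "N (D * X) \<le> d * N X"
    using N_mult[OF dims(3,4,3) D Xm] mult_right_mono[OF d' n0(5)] by linarith
  have NXD: "N (X * D) \<le> d * N X"
    using N_mult[OF dims(4,3,4) Xm D] mult_right_mono[OF d' n0(5)] by (simp add: mult.commute)
  have NDXD: "N (D * X * D) \<le> d\<^sup>2 * N X"
  proof -
    have "N (D * X * D) \<le> N (D * X) * N D" by (rule N_mult[OF dims(3,3,4) DX D])
    also have "\<dots> \<le> (d * N X) * d" using NDX d' n0 d0 by (intro mult_mono) auto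
    finally show ?thesis by (simp add: power2_eq_square mult.commute mult.left_commute)
  qed
  have NU: "N (U - U * X * U) \<le> 2 * d + d\<^sup>2 * N X"
    unfolding UXU
    using N_diff[OF dims(3,4) mats_minus[OF DQ PD] DXD] N_diff[OF dims(3,4) DQ PD]
      N_mult_projection[OF dims(3,4) Q D] N_projection_mult[OF dims(3,4) P' D] NDXD d'
    by linarith
  have UXm: "U * X \<in> mats K p p" by (rule mats_mult[OF U Xm])
  have XUm: "X * U \<in> mats K q q" by (rule mats_mult[OF Xm U])
  have UmXU: "U - U * X * U \<in> mats K p q" by (rule mats_minus[OF U mats_mult[OF UXm U]])
  have LU: "L * U \<in> mats K m q" by (rule mats_mult[OF L U])
  have UR: "U * R \<in> mats K p n" by (rule mats_mult[OF U R])
  note c' = mats_carrier[OF UXm] mats_carrier[OF XUm] mats_carrier[OF LU] mats_carrier[OF UR]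
  have t1: "N (L * (U - U * X * U) * R) \<le> N L * N R * (2 * d + d\<^sup>2 * N X)"
  proof -
    have "N (L * (U - U * X * U) * R) \<le> N (L * (U - U * X * U)) * N R"
      by (rule N_mult[OF dims(1,4,2) mats_mult[OF L UmXU] R])
    also have "\<dots> \<le> (N L * N (U - U * X * U)) * N R"
      by (rule mult_right_mono[OF N_mult[OF dims(1,3,4) L UmXU] n0(2)])
    also have "\<dots> \<le> (N L * (2 * d + d\<^sup>2 * N X)) * N R"
      by (intro mult_right_mono mult_left_mono NU n0)
    finally show ?thesis by (simp add: mult.commute mult.left_commute)
  qed
  have t2: "N (L * (U * X * EI)) \<le> N L * N EI * (1 + d * N X)"
  proof -
    have "U * X * EI = P * EI - D * X * EI"
      unfolding UX using PQc mats_carrier[OF DX] c by (simp add: minus_mult_distrib_mat[of _ p p _ _ n])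
    hence "N (U * X * EI) \<le> N (P * EI) + N (D * X * EI)"
      using N_diff[OF dims(3,2) mats_mult[OF P(1) EI] mats_mult[OF DX EI]] by simp
    also have "\<dots> \<le> N EI + d * N X * N EI"
      using N_projection_mult[OF dims(3,2) P EI] N_mult[OF dims(3,3,2) DX EI]
        mult_right_mono[OF NDX n0(3)] by linarith
    finally have *: "N (U * X * EI) \<le> N EI * (1 + d * N X)" by (simp add: algebra_simps)
    have "N (L * (U * X * EI)) \<le> N L * N (U * X * EI)"
      by (rule N_mult[OF dims(1,3,2) L mats_mult[OF UXm EI]])
    also have "\<dots> \<le> N L * (N EI * (1 + d * N X))" by (rule mult_left_mono[OF * n0(1)])
    finally show ?thesis by (simp add: mult.assoc)
  qed
  have t3: "N (EJ * (X * U) * R) \<le> N R * N EJ * (1 + d * N X)"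
  proof -
    have "EJ * (X * U) = EJ * Q - EJ * (X * D)"
      unfolding XU using PQc mats_carrier[OF XD] c by (simp add: mult_minus_distrib_mat[of _ m q _ q])
    hence "N (EJ * (X * U)) \<le> N (EJ * Q) + N (EJ * (X * D))"
      using N_diff[OF dims(1,4) mats_mult[OF EJ Q(1)] mats_mult[OF EJ XD]] by simp
    also have "\<dots> \<le> N EJ + N EJ * (d * N X)"
      using N_mult_projection[OF dims(1,4) Q EJ] N_mult[OF dims(1,4,4) EJ XD]
        mult_left_mono[OF NXD n0(4)] by linarith
    finally have *: "N (EJ * (X * U)) \<le> N EJ * (1 + d * N X)" by (simp add: algebra_simps)
    have "N (EJ * (X * U) * R) \<le> N (EJ * (X * U)) * N R"
      by (rule N_mult[OF dims(1,4,2) mats_mult[OF EJ XUm] R])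
    also have "\<dots> \<le> (N EJ * (1 + d * N X)) * N R" by (rule mult_right_mono[OF * n0(2)])
    finally show ?thesis by (simp add: mult.commute mult.left_commute)
  qed
  have EJX: "EJ * X \<in> mats K m p" by (rule mats_mult[OF EJ Xm])
  have t4: "N (EJ * X * EI) \<le> N EJ * N X * N EI"
    using N_mult[OF dims(1,3,2) EJX EI] mult_right_mono[OF N_mult[OF dims(1,4,3) EJ Xm] n0(3)] by linarith
  have m1: "L * (U - U * X * U) * R \<in> mats K m n" by (intro mats_mult[OF mats_mult[OF L UmXU] R])
  have m2: "L * (U * X * EI) \<in> mats K m n" by (intro mats_mult[OF L] mats_mult[OF UXm EI])
  have m3: "EJ * (X * U) * R \<in> mats K m n" by (intro mats_mult[OF mats_mult[OF EJ XUm] R])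
  have m4: "EJ * X * EI \<in> mats K m n" by (intro mats_mult[OF EJX EI])
  have LUR: "L * U * R \<in> mats K m n" by (rule mats_mult[OF LU R])
  have LUXUR: "L * (U * X * U) * R \<in> mats K m n"
    by (rule mats_mult[OF mats_mult[OF L mats_mult[OF UXm U]] R])
  \<comment> \<open>Four terms: the residual of \<open>U\<close>, the error in the rows, the error
    in the columns, and their product.\<close>
  have eq: "L * U * R - (L * U + EJ) * X * (U * R + EI) =
    L * (U - U * X * U) * R - (L * (U * X * EI) + (EJ * (X * U) * R + EJ * X * EI))"
  proof -
    have h1: "(L * U + EJ) * X * (U * R + EI) = (L * U + EJ) * X * (U * R) + (L * U + EJ) * X * EI"
      by (rule mult_add_distrib_mat[of _ m p _ n]) (use c c' in \<open>auto intro!: mult_carrier_mat[of _ m q]\<close>)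
    have h2: "(L * U + EJ) * X = L * U * X + EJ * X"
      by (rule add_mult_distrib_mat[of _ m q _ _ p]) (use c c' in auto)
    have h3: "(L * U * X + EJ * X) * (U * R) = L * U * X * (U * R) + EJ * X * (U * R)"
      by (rule add_mult_distrib_mat[of _ m p _ _ n])
        (use c' mats_carrier[OF EJX] mats_carrier[OF mats_mult[OF LU Xm]] in auto)
    have h4: "(L * U * X + EJ * X) * EI = L * U * X * EI + EJ * X * EI"
      by (rule add_mult_distrib_mat[of _ m p _ _ n])
        (use c mats_carrier[OF EJX] mats_carrier[OF mats_mult[OF LU Xm]] in auto)
    have h5: "L * U * X * (U * R) = L * (U * X * U) * R" "EJ * X * (U * R) = EJ * (X * U) * R"
      "L * U * X * EI = L * (U * X * EI)"
      using c by (simp_all add: mat_mult_assoc)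
    have 1: "(L * U + EJ) * X * (U * R + EI) =
      L * (U * X * U) * R + EJ * (X * U) * R + (L * (U * X * EI) + EJ * X * EI)"
      unfolding h1 unfolding h2 unfolding h3 h4 unfolding h5 ..
    have "L * (U - U * X * U) * R = (L * U - L * (U * X * U)) * R"
      using c mats_carrier[OF mats_mult[OF UXm U]] by (simp add: mult_minus_distrib_mat[of _ m p _ q])
    also have "\<dots> = L * U * R - L * (U * X * U) * R"
      by (rule minus_mult_distrib_mat[of _ m q _ _ n])
        (use c c' mats_carrier[OF mats_mult[OF L mats_mult[OF UXm U]]] in auto)
    finally have 2: "L * (U - U * X * U) * R = L * U * R - L * (U * X * U) * R" .
    have add: "a - (b + f + (e + g)) = a - b - (e + (f + g))"
      if "a \<in> carrier_mat m n" "b \<in> carrier_mat m n" "e \<in> carrier_mat m n" "f \<in> carrier_mat m n"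
        "g \<in> carrier_mat m n" for a b e f g :: "complex mat"
      using that by (intro eq_matI) auto
    show ?thesis unfolding 1 2
      by (rule add) (intro mats_carrier[OF LUR] mats_carrier[OF LUXUR] mats_carrier[OF m2]
        mats_carrier[OF m3] mats_carrier[OF m4])+
  qed
  show ?thesis unfolding eq
    using N_diff[OF dims(1,2) m1 mats_add[OF m2 mats_add[OF m3 m4]]]
      N_add[OF dims(1,2) m2 mats_add[OF m3 m4]] N_add[OF dims(1,2) m3 m4] t1 t2 t3 t4
    by linarith
qed

end

section \<open>Truncated SVDs and the final estimate\<close>

text \<open>The last conclusion retains the full unitary factors behind the truncated ones, since
  unitary invariance cannot be applied to \<open>Wk\<close> and \<open>Vk\<close>
  themselves.\<close>

lemma truncated_svdD:
  assumes "scalar_field K" and B: "B \<in> mats K p q" and svd: "is_truncated_svd K k B Wk Sk Vk"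
  shows "k \<le> min p q" "Wk \<in> mats K p k" "Vk \<in> mats K q k"
    "mat_adjoint Wk * Wk = 1\<^sub>m k" "mat_adjoint Vk * Vk = 1\<^sub>m k" "Sk = rect_diag k k (\<lambda>i. sv B (Suc i))"
    "\<exists>W V. is_svd K B W V \<and> Wk * Sk * mat_adjoint Vk =
      W * rect_diag p q (\<lambda>i. if i < k then sv B (Suc i) else 0) * mat_adjoint V"
proof -
  note Bc = mats_carrier[OF B]
  from svd Bc show k: "k \<le> min p q" by (simp add: is_truncated_svd_def)
  from svd obtain W V where WV: "is_svd K B W V" "Wk = submatrix W UNIV {..<k}"
    "Vk = submatrix V UNIV {..<k}" and Sk: "Sk = sv_diag k k B"
    by (auto simp: is_truncated_svd_def)
  have W: "W \<in> mats K p p" "is_unitary W" and V: "V \<in> mats K q q" "is_unitary V"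
    using WV(1) Bc by (auto simp: is_svd_def)
  have WW: "mat_adjoint W * W = 1\<^sub>m p" and VV: "mat_adjoint V * V = 1\<^sub>m q"
    using W V mats_carrier[OF W(1)] mats_carrier[OF V(1)] by (auto simp: is_unitary_def)
  have Wk: "Wk = mat p k (\<lambda>(i, j). W $$ (i, j))" and Vk: "Vk = mat q k (\<lambda>(i, j). V $$ (i, j))"
    unfolding WV(2,3) using submatrix_initial_cols[OF mats_carrier[OF W(1)]]
      submatrix_initial_cols[OF mats_carrier[OF V(1)]] k by auto
  show "Wk \<in> mats K p k" "Vk \<in> mats K q k" using W(1) V(1) k by (auto simp: Wk Vk mats_iff)
  show "mat_adjoint Wk * Wk = 1\<^sub>m k" "mat_adjoint Vk * Vk = 1\<^sub>m k"
    unfolding Wk Vk using k initial_cols_isometry[OF mats_carrier[OF W(1)] WW]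
      initial_cols_isometry[OF mats_carrier[OF V(1)] VV] by auto
  show Sk': "Sk = rect_diag k k (\<lambda>i. sv B (Suc i))" by (simp add: Sk sv_diag_rect_diag)
  show "\<exists>W V. is_svd K B W V \<and> Wk * Sk * mat_adjoint Vk =
      W * rect_diag p q (\<lambda>i. if i < k then sv B (Suc i) else 0) * mat_adjoint V"
    using WV(1) truncated_product[OF mats_carrier[OF W(1)] mats_carrier[OF V(1)] k]
    unfolding Wk Vk Sk' by blast
qed

theorem theorem5p8:
  fixes K :: "complex set" and N :: "complex mat \<Rightarrow> real" and \<mu> :: real
    and m n k :: nat and I J :: "nat set"
    and A E A' Wk Sk Vk U C' R' U' EI EJ EIJ WkI VkJ Wt St Vt Utk :: "complex mat"
  assumes "K = \<real> \<or> K = UNIV"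
    and "matrix_norm_family K N" and "normalized_norm K N" and "uniformly_generated K N"
    and "unitarily_invariant K N" and "submultiplicative_norm K N"
    and "pinv_perturbation_const K N \<mu>"
    and "A \<in> mats K m n" and "E \<in> mats K m n" and "A' = A + E"
    and "mat_rank A = k" and "k \<ge> 1"
    and "is_truncated_svd K k A Wk Sk Vk"
    and "I \<subseteq> {..<m}" and "J \<subseteq> {..<n}"
    and "U = submatrix A I J"
    and "C' = submatrix A' UNIV J" and "R' = submatrix A' I UNIV" and "U' = submatrix A' I J"
    and "EI = submatrix E I UNIV" and "EJ = submatrix E UNIV J" and "EIJ = submatrix E I J"
    and "WkI = submatrix Wk I UNIV" and "VkJ = submatrix Vk J UNIV"
    and "is_truncated_svd K k U' Wt St Vt" and "Utk = Wt * St * mat_adjoint Vt"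
    and "mat_rank U = k" and "sv U k > 2 * \<mu> * N EIJ"
  shows "N (A - C' * pinv Utk * R')
    \<le> N (pinv U) / (1 - 2 * \<mu> * spectral_norm (pinv U) * N EIJ) *
        (2 * N EIJ * (N EI * N (pinv WkI) + N EJ * N (pinv VkJ)
            + 2 * N EIJ * N (pinv WkI) * N (pinv VkJ))
          + N EI * N EJ)
      + N (pinv WkI) * N EI + N (pinv VkJ) * N EJ
      + 6 * N (pinv WkI) * N (pinv VkJ) * N EIJ"
proof -
  interpret invariant_norm K N by unfold_locales (rule assms)+
  note k1 = \<open>k \<ge> 1\<close> and Am = \<open>A \<in> mats K m n\<close> and Em = \<open>E \<in> mats K m n\<close>
  note Ac = mats_carrier[OF Am] and Ec = mats_carrier[OF Em]
  have \<mu>: "1 \<le> \<mu>" using assms(7) by (simp add: pinv_perturbation_const_def)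
  define p where "p = card {i. i < m \<and> i \<in> I}"
  define q where "q = card {j. j < n \<and> j \<in> J}"
  note svdA = truncated_svdD[OF scalar_field_axioms Am assms(13)]
  have A'm: "A' \<in> mats K m n" unfolding assms(10) by (rule mats_add[OF Am Em])
  have Um: "U \<in> mats K p q" and U'm: "U' \<in> mats K p q" and EIJm: "EIJ \<in> mats K p q"
    unfolding assms p_def q_def using submatrix_mats[OF Am] submatrix_mats[OF A'm] submatrix_mats[OF Em]
    by (auto simp: assms(10))
  have EIm: "EI \<in> mats K p n" and EJm: "EJ \<in> mats K m q"
    using submatrix_mats[OF Em, of I UNIV] submatrix_mats[OF Em, of UNIV J]
    by (auto simp: assms(20,21) p_def q_def)
  note svdU = truncated_svdD[OF scalar_field_axioms U'm assms(25)]
  have dims: "1 \<le> m" "1 \<le> n" "1 \<le> p" "1 \<le> q" using svdA(1) svdU(1) k1 by auto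
  have WIm: "WkI \<in> mats K p k" and VJm: "VkJ \<in> mats K q k"
    using submatrix_mats[OF svdA(2), of I UNIV] submatrix_mats[OF svdA(3), of J UNIV]
    by (auto simp: assms(23,24) p_def q_def)
  note Uc = mats_carrier[OF Um] and WIc = mats_carrier[OF WIm] and VJc = mats_carrier[OF VJm]
    and Wkc = mats_carrier[OF svdA(2)] and Vkc = mats_carrier[OF svdA(3)]
  have Skc: "Sk \<in> carrier_mat k k" by (simp add: svdA(6))

  \<comment> \<open>\<open>A\<close> has rank \<open>k\<close>, so its singular values after the
    \<open>k\<close>-th vanish and truncation changes nothing.\<close>
  have A_eq: "A = Wk * Sk * mat_adjoint Vk"
  proof -
    obtain L G where LG: "L \<in> carrier_mat m k" "G \<in> carrier_mat k n" "A = L * G"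
      using rank_factorization[OF Ac] assms(11) by metis
    have "sv A (Suc i) = 0" if "k \<le> i" for i
      unfolding LG(3) by (rule sv_of_low_rank[OF LG(1,2)]) (use that in simp)
    hence "(\<lambda>i. if i < k then sv A (Suc i) else 0) = (\<lambda>i. sv A (Suc i))" by auto
    with svdA(7) obtain W V where "is_svd K A W V"
      "Wk * Sk * mat_adjoint Vk = W * sv_diag m n A * mat_adjoint V"
      by (auto simp: sv_diag_rect_diag)
    thus ?thesis using Ac by (simp add: is_svd_def)
  qed
  have sub: "submatrix A I' J' = submatrix Wk I' UNIV * Sk * mat_adjoint (submatrix Vk J' UNIV)" for I' J'
    using Wkc Vkc Skc unfolding A_eq
    by (simp add: submatrix_mult submatrix_adjoint)
  have U_eq: "U = WkI * Sk * mat_adjoint VkJ" unfolding assms(16,23,24) by (rule sub)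
  have C_eq: "submatrix A UNIV J = Wk * Sk * mat_adjoint VkJ" using sub[of UNIV J] by (simp add: assms(24))
  have R_eq: "submatrix A I UNIV = WkI * Sk * mat_adjoint Vk" using sub[of I UNIV] by (simp add: assms(23))

  have e0: "0 \<le> N EIJ" by (rule N_nonneg[OF dims(3,4) EIJm])
  have pos: "0 < sv U k"
    using assms(28) e0 \<mu> mult_nonneg_nonneg[of "2 * \<mu>" "N EIJ"] by linarith
  \<comment> \<open>Writes \<open>U\<close> as a product through \<open>k\<close> dimensions;
    positivity of \<open>sv U k\<close> then forces full column rank on both factors.\<close>
  define H where "H = VkJ * mat_adjoint Sk"
  have Hc: "H \<in> carrier_mat q k" unfolding H_def by (rule mult_carrier_mat[OF VJc mat_adjoint_carrier[OF Skc]])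
  have UH: "U = WkI * mat_adjoint H"
    unfolding U_eq H_def using WIc VJc Skc by (simp add: mat_adjoint_times mat_mult_assoc)
  have injW: "injective_mat WkI" and injH: "injective_mat H"
    using injective_factors[OF WIc Hc k1] pos unfolding UH by auto
  \<comment> \<open>\<open>H\<close> contains the factor \<open>Sk\<close>, so \<open>VkJ\<close> is
    treated separately, as the left factor of the adjoint of \<open>U\<close>.\<close>
  have injV: "injective_mat VkJ"
  proof (rule injective_left_factor[OF VJc])
    show "mat_adjoint Sk * mat_adjoint WkI \<in> carrier_mat k p"
      by (rule mult_carrier_mat[OF mat_adjoint_carrier[OF Skc] mat_adjoint_carrier[OF WIc]])
    have "mat_adjoint U = VkJ * (mat_adjoint Sk * mat_adjoint WkI)"
      unfolding U_eq using WIc VJc Skc by (simp add: mat_adjoint_times mat_mult_assoc)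
    thus "0 < sv (VkJ * (mat_adjoint Sk * mat_adjoint WkI)) k" using pos sv_adjoint[OF k1, of U] by simp
  qed
  note pW = pinv_injective_mat[OF WIc injW] and pV = pinv_injective_mat[OF VJc injV]
  have pWm: "pinv WkI \<in> mats K k p" and pVm: "pinv VkJ \<in> mats K k q"
    using is_pinv_mats[OF WIm pW(1)] is_pinv_mats[OF VJm pV(1)] by auto
  note pWc = mats_carrier[OF pWm] and pVc = mats_carrier[OF pVm]
  \<comment> \<open>Since \<open>Wk\<close> and \<open>Vk\<close> have orthonormal columns,
    \<open>Lw\<close> and \<open>Rv\<close> have exactly the norms of \<open>pinv WkI\<close> and
    \<open>pinv VkJ\<close>.\<close>
  define Lw where "Lw = Wk * pinv WkI"
  define Rv where "Rv = mat_adjoint (Vk * pinv VkJ)"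
  have Lwm: "Lw \<in> mats K m p" unfolding Lw_def by (rule mats_mult[OF svdA(2) pWm])
  have Rvm: "Rv \<in> mats K q n" unfolding Rv_def by (rule mats_adjoint[OF mats_mult[OF svdA(3) pVm]])
  have NL: "N Lw = N (pinv WkI)"
    unfolding Lw_def by (rule N_isometry_mult[OF dims(1) k1 dims(3) svdA(2,4) pWm])
  have NR: "N Rv = N (pinv VkJ)"
    unfolding Rv_def N_adjoint[OF dims(2,4) mats_mult[OF svdA(3) pVm]]
    by (rule N_isometry_mult[OF dims(2) k1 dims(4) svdA(3,5) pVm])
  have pVadj: "mat_adjoint VkJ * mat_adjoint (pinv VkJ) = 1\<^sub>m k"
    using arg_cong[OF pV(2), of mat_adjoint] pVc VJc by (simp add: mat_adjoint_times)
  have LU: "Lw * U = submatrix A UNIV J"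
  proof -
    have "Lw * U = Wk * ((pinv WkI * WkI) * (Sk * mat_adjoint VkJ))"
      unfolding Lw_def U_eq using Wkc pWc WIc Skc VJc by (simp add: mat_mult_assoc)
    thus ?thesis unfolding pW(2) C_eq using Wkc Skc VJc by (simp add: mat_mult_assoc)
  qed
  have UR: "U * Rv = submatrix A I UNIV"
  proof -
    have "U * Rv = WkI * (Sk * ((mat_adjoint VkJ * mat_adjoint (pinv VkJ)) * mat_adjoint Vk))"
      unfolding Rv_def U_eq using Vkc pVc WIc Skc VJc by (simp add: mat_mult_assoc mat_adjoint_times)
    thus ?thesis unfolding pVadj R_eq using Vkc WIc Skc by (simp add: mat_mult_assoc)
  qed
  have LUR: "Lw * U * Rv = A"
  proof -
    have "Lw * U * Rv = Wk * (Sk * ((mat_adjoint VkJ * mat_adjoint (pinv VkJ)) * mat_adjoint Vk))"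
      unfolding LU C_eq Rv_def using Vkc pVc Wkc Skc VJc by (simp add: mat_mult_assoc mat_adjoint_times)
    thus ?thesis unfolding pVadj using A_eq Vkc Wkc Skc by (simp add: mat_mult_assoc)
  qed
  have C': "C' = Lw * U + EJ" and R': "R' = U * Rv + EI"
    unfolding LU UR assms(17,18,20,21,10) by (rule submatrix_add[OF Ac Ec])+
  have U': "U' = U + EIJ"
    unfolding assms(16,19,22,10) by (rule submatrix_add[OF Ac Ec])

  have Utkm: "Utk \<in> mats K p q"
    unfolding assms(26) svdU(6)
    by (rule mats_mult[OF mats_mult[OF svdU(2) mats_rect_diag] mats_adjoint[OF svdU(3)]])
  define D where "D = Utk - U"
  have Dm: "D \<in> mats K p q" unfolding D_def by (rule mats_minus[OF Utkm Um])
  \<comment> \<open>\<open>U\<close> is itself a competitor of rank at most \<open>k\<close>,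
    differing from \<open>U'\<close> by \<open>EIJ\<close>. So \<open>Utk\<close> is within
    \<open>N EIJ\<close> of \<open>U'\<close>, which is within \<open>N EIJ\<close> of
    \<open>U\<close>.\<close>
  have ND: "N D \<le> 2 * N EIJ"
  proof -
    obtain W V where WV: "is_svd K U' W V" "Utk =
        W * rect_diag p q (\<lambda>i. if i < k then sv U' (Suc i) else 0) * mat_adjoint V"
      using svdU(7) assms(26) by auto
    have diff: "U' - WkI * mat_adjoint H = EIJ"
      unfolding U' UH[symmetric] using Uc mats_carrier[OF EIJm] by (intro eq_matI) auto
    have "N (U' - Utk) \<le> N EIJ"
      using mirsky_low_rank[OF dims(3,4) U'm WV(1) svdU(1) WIc mat_adjoint_carrier[OF Hc]] EIJm
      unfolding diff WV(2)[symmetric] by simp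
    hence "N (Utk - U') \<le> N EIJ" using N_minus_commute[OF dims(3,4) Utkm U'm] by simp
    moreover have "D = (Utk - U') + EIJ"
      unfolding D_def U' using Uc mats_carrier[OF EIJm] mats_carrier[OF Utkm] by (intro eq_matI) auto
    ultimately show ?thesis using N_add[OF dims(3,4) mats_minus[OF Utkm U'm] EIJm] by simp
  qed
  have e\<mu>: "N EIJ \<le> \<mu> * N EIJ" using mult_right_mono[OF \<mu> e0] by simp
  \<comment> \<open>Here \<open>\<mu> \<ge> 1\<close> turns the gap hypothesis into
    \<open>2 * N EIJ < sv U k\<close>, enough to keep the rank of \<open>Utk\<close> at
    \<open>k\<close>.\<close>
  have "sv D 1 < sv U k"
    using spectral_norm_le_N[OF dims(3,4) Dm] ND e\<mu> assms(28) unfolding spectral_norm_def by linarith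
  hence "0 < sv (U + D) k" by (rule sv_perturbed_pos[OF Uc mats_carrier[OF Dm] k1])
  moreover have "U + D = Utk"
    unfolding D_def using Uc mats_carrier[OF Utkm] by (intro eq_matI) auto
  ultimately have posT: "0 < sv Utk k" by simp
  define Ht where "Ht = Vt * mat_adjoint St"
  have Stc: "St \<in> carrier_mat k k" by (simp add: svdU(6))
  note Wtc = mats_carrier[OF svdU(2)] and Vtc = mats_carrier[OF svdU(3)]
  have Htc: "Ht \<in> carrier_mat q k" unfolding Ht_def by (rule mult_carrier_mat[OF Vtc mat_adjoint_carrier[OF Stc]])
  have TH: "Utk = Wt * mat_adjoint Ht"
    unfolding assms(26) Ht_def using Wtc Vtc Stc by (simp add: mat_adjoint_times mat_mult_assoc)
  have injT: "injective_mat Wt" "injective_mat Ht"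
    using injective_factors[OF Wtc Htc k1] posT unfolding TH by auto
  have X: "is_pinv Utk (pinv Utk)"
    unfolding TH by (rule is_pinv_full_rank_factorization[OF Wtc injT(1) Htc injT(2)])
  have Y: "is_pinv U (pinv U)"
    unfolding UH by (rule is_pinv_full_rank_factorization[OF WIc injW Hc injH])
  have rankT: "mat_rank Utk = k"
    unfolding TH by (rule mat_rank_full_rank_factorization[OF Wtc injT(1) Htc injT(2)])
  have Xm: "pinv Utk \<in> mats K q p" and Ym: "pinv U \<in> mats K q p"
    using is_pinv_mats[OF Utkm X] is_pinv_mats[OF Um Y] by auto

  let ?y = "spectral_norm (pinv U)" and ?e = "N EIJ" and ?x = "N (pinv Utk)"
  let ?b = "N (pinv U) / (1 - 2 * \<mu> * ?y * ?e)"
  have y0: "0 \<le> ?y" by (simp add: spectral_norm_def)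
  have x0: "0 \<le> ?x" by (rule N_nonneg[OF dims(4,3) Xm])
  have y: "?y * sv U k \<le> 1"
    by (rule spectral_norm_pinv[OF Uc Y]) (simp add: UH sv_of_low_rank[OF WIc mat_adjoint_carrier[OF Hc]])
  \<comment> \<open>For \<open>?y = 0\<close> the denominator is 1. Otherwise the gap hypothesis
    times \<open>?y\<close> gives \<open>2 * \<mu> * ?y * ?e < ?y * sv U k \<le> 1\<close>.\<close>
  have den: "0 < 1 - 2 * \<mu> * ?y * ?e"
  proof (cases "?y = 0")
    case False
    hence "?y * (2 * \<mu> * ?e) < ?y * sv U k" using y0 assms(28) by (intro mult_strict_left_mono) auto
    thus ?thesis using y by (simp add: mult.commute mult.left_commute)
  qed simp
  have "N (pinv Utk - pinv U) \<le> \<mu> * ?y * spectral_norm (pinv Utk) * N (U - Utk)"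
    using assms(7) dims(3,4) Utkm Um rankT assms(27) unfolding pinv_perturbation_const_def by metis
  also have "N (U - Utk) = N D" unfolding D_def by (rule N_minus_commute[OF dims(3,4) Um Utkm])
  \<comment> \<open>Bounding \<open>spectral_norm (pinv Utk)\<close> by \<open>?x\<close> makes the
    unknown appear on the right; the resulting inequality is linear in \<open>?x\<close> and is
    solved below.\<close>
  also have "\<mu> * ?y * spectral_norm (pinv Utk) * N D \<le> \<mu> * ?y * ?x * (2 * ?e)"
    using \<mu> y0 x0 ND N_nonneg[OF dims(3,4) Dm] spectral_norm_le_N[OF dims(4,3) Xm]
    by (intro mult_mono mult_nonneg_nonneg) (auto simp: spectral_norm_def)
  finally have "N (pinv Utk - pinv U) \<le> \<mu> * ?y * ?x * (2 * ?e)" .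
  moreover have "pinv Utk = pinv U + (pinv Utk - pinv U)"
    using mats_carrier[OF Xm] mats_carrier[OF Ym] by (intro eq_matI) auto
  hence "?x \<le> N (pinv U) + N (pinv Utk - pinv U)"
    using N_add[OF dims(4,3) Ym mats_minus[OF Xm Ym]] by simp
  ultimately have "?x * (1 - 2 * \<mu> * ?y * ?e) \<le> N (pinv U)" by (simp add: algebra_simps)
  hence xb: "?x \<le> ?b" using den by (simp add: pos_le_divide_eq)

  let ?w = "N (pinv WkI)" and ?v = "N (pinv VkJ)" and ?i = "N EI" and ?j = "N EJ"
  have n0: "0 \<le> ?w" "0 \<le> ?v" "0 \<le> ?i" "0 \<le> ?j"
    using N_nonneg[OF k1 dims(3) pWm] N_nonneg[OF k1 dims(4) pVm] N_nonneg[OF dims(3,2) EIm]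
      N_nonneg[OF dims(1,4) EJm] by auto
  \<comment> \<open>The right side of \<open>cur_error_bound\<close> at \<open>d = 2 * e\<close>,
    with the terms containing \<open>b\<close> collected; \<open>2 * d\<close> becomes the
    coefficient 4.\<close>
  have collect: "w * v * (2 * (2 * e) + (2 * e)\<^sup>2 * b) + w * i * (1 + 2 * e * b) + v * j * (1 + 2 * e * b)
      + j * b * i = b * (2 * e * (i * w + j * v + 2 * e * w * v) + i * j)
      + w * i + v * j + 4 * w * v * e" for w v i j e b :: real
    by (simp add: power2_eq_square algebra_simps)
  have "N (A - C' * pinv Utk * R') \<le>
    ?w * ?v * (2 * (2 * ?e) + (2 * ?e)\<^sup>2 * ?x) + ?w * ?i * (1 + 2 * ?e * ?x)
      + ?v * ?j * (1 + 2 * ?e * ?x) + ?j * ?x * ?i"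
    using cur_error_bound[OF dims Lwm Um Rvm EIm EJm Utkm X ND[unfolded D_def]]
    unfolding C' R' LUR NL NR .
  also have "\<dots> \<le> ?w * ?v * (2 * (2 * ?e) + (2 * ?e)\<^sup>2 * ?b) + ?w * ?i * (1 + 2 * ?e * ?b)
      + ?v * ?j * (1 + 2 * ?e * ?b) + ?j * ?b * ?i"
    using n0 e0 xb
    by (intro add_mono mult_left_mono mult_right_mono mult_nonneg_nonneg order_refl) auto
  also have "\<dots> = ?b * (2 * ?e * (?i * ?w + ?j * ?v + 2 * ?e * ?w * ?v) + ?i * ?j)
      + ?w * ?i + ?v * ?j + 4 * ?w * ?v * ?e"
    by (rule collect)
  \<comment> \<open>The estimate arrives at the coefficient 4 in the last term and is relaxed to the
    stated 6.\<close>
  also have "\<dots> \<le> ?b * (2 * ?e * (?i * ?w + ?j * ?v + 2 * ?e * ?w * ?v) + ?i * ?j)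
      + ?w * ?i + ?v * ?j + 6 * ?w * ?v * ?e"
    using n0 e0 by (intro add_left_mono mult_right_mono) auto
  finally show ?thesis .
qed

end
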